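(* For every $d\in\mathbb N$ and every $1\le q\le\infty$ there exists a constant $C(d,q)$, depending only on $d$ and $q$, such that for every $n\in\mathbb N$ there is a set $\Xi_m=\{\xi^\nu\}_{\nu=1}^m\subset\mathbb T^d$ with $m\le C(d,q)2^n$ that provides universal discretization in $L_q$ for the collection $\mathcal C(n,d)$.
   Context: $\mathbb T^d:=[0,2\pi)^d$ with the normalized Lebesgue measure, so $\|f\|_q:=\big((2\pi)^{-d}\int_{\mathbb T^d}|f(\mathbf x)|^q\,d\mathbf x\big)^{1/q}$ for $1\le q<\infty$, and $\|f\|_\infty:=\sup_{\mathbf x}|f(\mathbf x)|$ (for continuous $f$). For a finite $Q\subset\mathbb Z^d$, $\mathcal T(Q):=\{f=\sum_{\mathbf k\in Q}c_{\mathbf k}e^{i(\mathbf k,\mathbf x)}:\ c_{\mathbf k}\in\mathbb C\}$. For $\mathbf s\in\mathbb Z_+^d$ let $R(\mathbf s):=\{\mathbf k\in\mathbb Z^d:|k_j|<2^{s_j},\ j=1,\dots,d\}$, and let $\mathcal C(n,d):=\{\mathcal T(R(\mathbf s)):\ \mathbf s\in\mathbb Z_+^d,\ \|\mathbf s\|_1=n\}$. A set $\{\xi^\nu\}_{\nu=1}^m\subset\mathbb T^d$ provides universal discretization in $L_q$ for a collection of subspaces $\{X^j\}_{j=1}^k$ if: for $1\le q<\infty$ there are positive constants $C_1(d,q),C_2(d,q)$ (independent of $j$, $n$) such that for every $j$ and every $f\in X^j$, $C_1(d,q)\|f\|_q^q\le \frac1m\sum_{\nu=1}^m|f(\xi^\nu)|^q\le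 C_2(d,q)\|f\|_q^q$; for $q=\infty$ there is a positive constant $C_1(d)$ such that for every $j$ and every $f\in X^j$, $C_1(d)\|f\|_\infty\le\max_{1\le\nu\le m}|f(\xi^\nu)|\le\|f\|_\infty$. *)

theory Defs
  imports "HOL-Analysis.Analysis"
begin

text \<open>The torus [0,2pi)^d; the dimension d is CARD('d) of a finite index type.\<close>
definition torus :: "(real^'d::finite) set" where
  "torus = {x. \<forall>j. 0 \<le> x$j \<and> x$j < 2 * pi}"

definition trig_polys :: "('d::finite \<Rightarrow> int) set \<Rightarrow> (real^'d \<Rightarrow> complex) set" where
  "trig_polys Q = {f. \<exists>c. \<forall>x. f x =
      (\<Sum>k\<in>Q. c k * exp (\<i> * complex_of_real (\<Sum>j\<in>UNIV. real_of_int (k j) * x$j)))}"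

definition rect :: "('d::finite \<Rightarrow> nat) \<Rightarrow> ('d \<Rightarrow> int) set" where
  "rect s = {k. \<forall>j. \<bar>k j\<bar> < 2 ^ (s j)}"

definition hcross_coll :: "nat \<Rightarrow> (real^'d::finite \<Rightarrow> complex) set set" where
  "hcross_coll n = {trig_polys (rect s) | s :: 'd \<Rightarrow> nat. (\<Sum>j\<in>UNIV. s j) = n}"

definition Lq_norm_pow :: "real \<Rightarrow> (real^'d::finite \<Rightarrow> complex) \<Rightarrow> real" where
  "Lq_norm_pow q f = integral (torus :: (real^'d) set) (\<lambda>x. norm (f x) powr q) / (2 * pi) ^ CARD('d)"

definition sup_norm :: "(real^'d::finite \<Rightarrow> complex) \<Rightarrow> real" where
  "sup_norm f = (SUP x\<in>(torus :: (real^'d) set). norm (f x))"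

definition udisc_Lq :: "real \<Rightarrow> real \<Rightarrow> real \<Rightarrow> nat \<Rightarrow> (nat \<Rightarrow> real^'d::finite)
    \<Rightarrow> (real^'d \<Rightarrow> complex) set set \<Rightarrow> bool" where
  "udisc_Lq q C1 C2 m \<xi> Xs \<longleftrightarrow>
     (\<forall>X\<in>Xs. \<forall>f\<in>X.
        C1 * Lq_norm_pow q f \<le> (\<Sum>\<nu><m. norm (f (\<xi> \<nu>)) powr q) / real m \<and>
        (\<Sum>\<nu><m. norm (f (\<xi> \<nu>)) powr q) / real m \<le> C2 * Lq_norm_pow q f)"

definition udisc_Linf :: "real \<Rightarrow> nat \<Rightarrow> (nat \<Rightarrow> real^'d::finite)
    \<Rightarrow> (real^'d \<Rightarrow> complex) set set \<Rightarrow> bool" where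
  "udisc_Linf C1 m \<xi> Xs \<longleftrightarrow>
     (\<forall>X\<in>Xs. \<forall>f\<in>X.
        C1 * sup_norm f \<le> (MAX \<nu>\<in>{..<m}. norm (f (\<xi> \<nu>))) \<and>
        (MAX \<nu>\<in>{..<m}. norm (f (\<xi> \<nu>))) \<le> sup_norm f)"

end

theory Submission
  imports Defs "HOL-Number_Theory.Cong" "HOL-Computational_Algebra.Primes"
begin

text \<open>
  The points are the first \<open>m\<close> points of the Halton sequence in pairwise coprime bases \<open>p\<^sub>j\<close>. For a shape
  \<open>s\<close>, let \<open>M\<^sub>j\<close> be the first power of \<open>p\<^sub>j\<close> above \<open>2 ^ (s\<^sub>j + a)\<close>. By coprimality every block of
  \<open>\<Prod>\<^sub>j M\<^sub>j\<close> consecutive Halton points has exactly one point in each cell of the grid with \<open>M\<^sub>j\<close> steps in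
  direction \<open>j\<close>, and the first \<open>m\<close> points contain one such block and are covered by boundedly many.

  It remains to compare sums of \<open>\<bar>f\<bar> ^ q\<close> over arbitrary choices of one point per cell. A discrete form of
  Bernstein's inequality writes the derivative of \<open>f\<close> at a grid point as a combination of the values of \<open>f\<close>
  on the shifted grid, with weights of total mass at most \<open>2 N\<close>. Exponentiating, the deviation of \<open>f\<close> inside a
  cell from its value at the corner is dominated by a convolution of \<open>\<bar>f\<bar>\<close> on the grid with a nonnegative
  kernel of mass at most 1/2, independent of the chosen points, so by convexity the deviations are small
  in every \<open>\<ell>\<^sub>q\<close>. The integral of \<open>\<bar>f\<bar> ^ q\<close> lies between two such sums, by taking the minimum and the
  maximum of \<open>\<bar>f\<bar>\<close> on each cell.
\<close>

subsection \<open>Van der Corput sequences\<close>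

text \<open>The value numbers the interval of length \<open>1 / p ^ c\<close> in the unit interval
  that contains the \<open>i\<close>-th van der Corput point.\<close>

fun digit_reversal :: "nat \<Rightarrow> nat \<Rightarrow> nat \<Rightarrow> nat" where
  "digit_reversal p 0 i = 0"
| "digit_reversal p (Suc c) i = (i mod p) * p ^ c + digit_reversal p c (i div p)"

text \<open>This is the radical inverse: the base-\<open>p\<close> digits of \<open>i\<close> are
  mirrored at the radix point. Only finitely many terms are nonzero; the infinite series avoids
  fixing a number of digits.\<close>

definition van_der_corput :: "nat \<Rightarrow> nat \<Rightarrow> real" where
  "van_der_corput p i = (\<Sum>k. real (i div p ^ k mod p) / real p ^ Suc k)"

lemma van_der_corput_summable:
  assumes "2 \<le> p"
  shows "summable (\<lambda>k. real (i div p ^ k mod p) / real p ^ Suc k)"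
proof (rule summable_finite[of "{..i}"])
  fix k assume "k \<notin> {..i}"
  moreover have "k < p ^ k"
    using assms by (intro power_gt_expt) auto
  ultimately show "real (i div p ^ k mod p) / real p ^ Suc k = 0"
    by simp
qed simp

lemma van_der_corput_rec:
  assumes "2 \<le> p"
  shows "van_der_corput p i = (real (i mod p) + van_der_corput p (i div p)) / real p"
proof -
  let ?t = "\<lambda>i k. real (i div p ^ k mod p) / real p ^ Suc k"
  have "van_der_corput p i = ?t i 0 + (\<Sum>k. ?t i (Suc k))"
    unfolding van_der_corput_def
    using suminf_split_head[OF van_der_corput_summable[OF assms, of i]] by linarith
  also have "(\<lambda>k. ?t i (Suc k)) = (\<lambda>k. ?t (i div p) k / real p)"
    by (simp add: fun_eq_iff div_mult2_eq mult.commute[of _ "real p"])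
  also have "(\<Sum>k. ?t (i div p) k / real p) = (\<Sum>k. ?t (i div p) k) / real p"
    by (rule suminf_divide[OF van_der_corput_summable[OF assms]])
  finally show ?thesis
    by (simp add: van_der_corput_def add_divide_distrib)
qed

lemma van_der_corput_nonneg: "2 \<le> p \<Longrightarrow> 0 \<le> van_der_corput p i"
  unfolding van_der_corput_def by (intro suminf_nonneg van_der_corput_summable) auto

text \<open>Splitting off the lowest digit gives at most \<open>(p - 1 + v) / p\<close> with
  \<open>v < 1\<close> by induction. Strictness is what puts the points into the half-open
  torus.\<close>

lemma van_der_corput_less_1:
  assumes "2 \<le> p"
  shows "van_der_corput p i < 1"
proof (induction i rule: less_induct)
  case (less i)
  show ?case
  proof (cases "i = 0")
    case True
    then show ?thesis by (simp add: van_der_corput_def)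
  next
    case False
    then have "van_der_corput p (i div p) < 1"
      using assms by (intro less) auto
    moreover have "real (i mod p) + 1 \<le> real p"
      using assms mod_less_divisor[of p i] by linarith
    ultimately show ?thesis
      using assms by (subst van_der_corput_rec) (auto simp: field_simps)
  qed
qed

text \<open>Multiplication by \<open>p ^ c\<close> moves \<open>c\<close> digits in front of the
  radix point. They form the integer part, and what remains is again a van der Corput value.\<close>

lemma van_der_corput_scaled:
  assumes "2 \<le> p"
  shows "real p ^ c * van_der_corput p i
    = real (digit_reversal p c i) + van_der_corput p (i div p ^ c)"
proof (induction c arbitrary: i)
  case (Suc c)
  have "real p ^ Suc c * van_der_corput p i
      = real p ^ c * (real (i mod p) + van_der_corput p (i div p))"
    using assms by (subst van_der_corput_rec) auto
  then show ?case
    by (simp add: distrib_left Suc div_mult2_eq)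
qed simp

lemma digit_reversal_less: "2 \<le> p \<Longrightarrow> digit_reversal p c i < p ^ c"
proof (induction c arbitrary: i)
  case (Suc c)
  have "(i mod p) * p ^ c + digit_reversal p c (i div p) < (i mod p) * p ^ c + p ^ c"
    using Suc by simp
  also have "\<dots> = Suc (i mod p) * p ^ c" by simp
  also have "\<dots> \<le> p * p ^ c"
    using Suc.prems mod_less_divisor[of p i] by (intro mult_right_mono) (auto simp: Suc_le_eq)
  finally show ?case by simp
qed simp

text \<open>Division by \<open>p ^ c\<close> with remainder recovers the lowest digit of
  \<open>i\<close> and the reversal of the other digits, so induction recovers all \<open>c\<close>
  digits.\<close>

lemma digit_reversal_inj:
  assumes "2 \<le> p" "digit_reversal p c i = digit_reversal p c i'"
  shows "i mod p ^ c = i' mod p ^ c"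
  using assms(2)
proof (induction c arbitrary: i i')
  case (Suc c)
  have dm: "digit_reversal p (Suc c) n div p ^ c = n mod p"
      "digit_reversal p (Suc c) n mod p ^ c = digit_reversal p c (n div p)" for n
    using digit_reversal_less[OF assms(1), of c "n div p"] assms(1) by auto
  have "i mod p = i' mod p" "digit_reversal p c (i div p) = digit_reversal p c (i' div p)"
    using dm[of i] dm[of i'] Suc.prems by metis+
  then show ?case
    using Suc.IH[of "i div p" "i' div p"] by (simp add: mod_mult2_eq)
qed simp

text \<open>The Chinese remainder theorem: the reversals determine \<open>i\<close> modulo every
  \<open>p j ^ c j\<close>, hence modulo \<open>G\<close>, hence inside a block of length
  \<open>G\<close>. Equal cardinalities turn injectivity into bijectivity.\<close>

lemma digit_reversal_bij_betw_block:
  fixes p :: "'d::finite \<Rightarrow> nat" and c :: "'d \<Rightarrow> nat"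
  assumes p: "\<And>j. 2 \<le> p j" and cop: "\<And>j j'. j \<noteq> j' \<Longrightarrow> coprime (p j) (p j')"
  defines "G \<equiv> (\<Prod>j\<in>UNIV. p j ^ c j)"
  shows "bij_betw (\<lambda>i j. digit_reversal (p j) (c j) i) {l * G ..< l * G + G}
    (Pi\<^sub>E UNIV (\<lambda>j. {..<p j ^ c j}))"
proof -
  let ?r = "\<lambda>i j. digit_reversal (p j) (c j) i"
  let ?X = "{l * G ..< l * G + G}" and ?Y = "Pi\<^sub>E UNIV (\<lambda>j. {..<p j ^ c j})"
  have "inj_on ?r ?X"
  proof (rule inj_onI)
    fix i i' assume i: "i \<in> ?X" "i' \<in> ?X" and eq: "?r i = ?r i'"
    have "[i = i'] (mod (\<Prod>j\<in>UNIV. p j ^ c j))"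
    proof (rule cong_cong_prod_coprime_nat)
      show "\<forall>j\<in>UNIV. [i = i'] (mod p j ^ c j)"
        unfolding cong_def using digit_reversal_inj[OF p fun_cong[OF eq]] by blast
      show "\<forall>j\<in>UNIV. \<forall>j'\<in>UNIV. j \<noteq> j' \<longrightarrow> coprime (p j ^ c j) (p j' ^ c j')"
        using cop by simp
    qed
    then have "i mod G = i' mod G" by (simp add: cong_def G_def)
    moreover have "n mod G = n - l * G" if "n \<in> ?X" for n
    proof -
      define r where "r = n - l * G"
      have "n = r + l * G" "r < G" using that by (auto simp: r_def)
      then show ?thesis by simp
    qed
    ultimately show "i = i'" using i by auto
  qed
  moreover have "?r ` ?X \<subseteq> ?Y" using digit_reversal_less[OF p] by auto
  moreover have "card ?Y = card ?X" by (simp add: card_PiE G_def)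
  moreover have "finite ?Y" by (simp add: finite_PiE)
  ultimately show ?thesis
    unfolding bij_betw_def by (simp add: card_subset_eq card_image)
qed

lemma ex_coprime_family: "\<exists>p::'d::finite \<Rightarrow> nat. (\<forall>j. 2 \<le> p j) \<and> (\<forall>j j'. j \<noteq> j' \<longrightarrow> coprime (p j) (p j'))"
proof -
  obtain P :: "nat set" where P: "card P = CARD('d)" "finite P" "P \<subseteq> {p. prime p}"
    using infinite_arbitrarily_large[OF primes_infinite] by metis
  then obtain p :: "'d \<Rightarrow> nat" where p: "bij_betw p UNIV P"
    using finite_same_card_bij[of "UNIV :: 'd set" P] by auto
  have "prime (p j)" for j
    using P(3) p by (auto simp: bij_betw_def)
  moreover have "p j \<noteq> p j'" if "j \<noteq> j'" for j j'
    using p that by (auto simp: bij_betw_def dest: injD)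
  ultimately have "(\<forall>j. 2 \<le> p j) \<and> (\<forall>j j'. j \<noteq> j' \<longrightarrow> coprime (p j) (p j'))"
    by (simp add: primes_coprime prime_ge_2_nat)
  then show ?thesis by blast
qed

subsection \<open>Differentiation and translation as discrete convolutions\<close>

text \<open>A geometric sum of powers of an \<open>M\<close>-th root of unity. The bound on
  \<open>p\<close> excludes nonzero multiples of \<open>M\<close>, for which that root would be
  1.\<close>

lemma sum_cis_equidistant:
  fixes p :: int and M :: nat
  assumes "\<bar>p\<bar> < int M"
  shows "(\<Sum>r<M. cis (of_int p * (2 * pi * real r / real M))) = (if p = 0 then of_nat M else 0)"
proof (cases "p = 0")
  case False
  define z where "z = cis (of_int p * (2 * pi / real M))"
  have M: "M > 0" using assms by auto
  have "z \<noteq> 1"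
  proof
    assume "z = 1"
    then have "cos (of_int p * (2 * pi / real M)) = 1"
      unfolding z_def by (metis cis.sel(1) one_complex.sel(1))
    then obtain n :: int where n: "of_int p * (2 * pi / real M) = of_int n * 2 * pi"
      using cos_one_2pi_int by metis
    have "real_of_int p = of_int n * real M"
      using n M by (simp add: field_simps)
    then have "real_of_int p = of_int (n * int M)" by simp
    then have "p = n * int M" using of_int_eq_iff by blast
    then show False
      using assms False by (metis dvd_imp_le_int dvd_triv_right abs_of_nat not_less)
  qed
  moreover have "z ^ M = 1"
    using M cis_multiple_2pi[of "of_int p"] by (simp add: z_def Complex.DeMoivre mult_ac)
  moreover have "cis (of_int p * (2 * pi * real r / real M)) = z ^ r" for r
    by (simp add: z_def Complex.DeMoivre field_simps)
  ultimately show ?thesis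
    using False by (simp add: geometric_sum)
qed simp

text \<open>These counts are the tent-shaped Fourier coefficients of \<open>N\<close> times the
  Fejer kernel.\<close>

lemma count_int_differences:
  fixes p :: int and N :: nat
  shows "(\<Sum>j\<in>{0..<int N}. \<Sum>l\<in>{0..<int N}. if l - j = p then 1 else 0) = (of_int (max 0 (int N - \<bar>p\<bar>)) :: complex)"
proof -
  have "(\<Sum>l\<in>{0..<int N}. if l - j = p then 1 else (0::complex))
      = (if j + p \<in> {0..<int N} then 1 else 0)" for j
  proof -
    have "(\<Sum>l\<in>{0..<int N}. if l - j = p then 1 else (0::complex))
        = (\<Sum>l\<in>{0..<int N}. if j + p = l then 1 else 0)"
      by (intro sum.cong) auto
    then show ?thesis by simp
  qed
  then have "(\<Sum>j\<in>{0..<int N}. \<Sum>l\<in>{0..<int N}. if l - j = p then 1 else 0)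
      = (\<Sum>j\<in>{0..<int N}. if j + p \<in> {0..<int N} then 1 else (0::complex))"
    by simp
  also have "\<dots> = (\<Sum>j\<in>{j\<in>{0..<int N}. j + p \<in> {0..<int N}}. 1)"
    by (rule sum.inter_filter[symmetric]) simp
  also have "{j\<in>{0..<int N}. j + p \<in> {0..<int N}} = {max 0 (- p)..<min (int N) (int N - p)}"
    by auto
  also have "(\<Sum>j\<in>\<dots>. 1 :: complex) = of_int (max 0 (int N - \<bar>p\<bar>))"
    by (auto simp: max_def min_def)
  finally show ?thesis .
qed

text \<open>The weights sample the kernel \<open>2 N sin (N t) F\<close> with \<open>F\<close> the Fejer kernel of order \<open>N\<close>:
  in the range \<open>\<bar>k\<bar> < N\<close> the Fourier coefficients of this kernel are those of differentiation, and \<open>F\<close> is nonnegative with mean 1.\<close>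
lemma discrete_Bernstein_weights:
  fixes N M :: nat
  assumes "3 * N \<le> M" "0 < N"
  obtains a :: "nat \<Rightarrow> complex" where
    "\<And>k. \<bar>k\<bar> < int N \<Longrightarrow> (\<Sum>r<M. a r * cis (of_int k * (2 * pi * real r / real M))) = \<i> * of_int k"
    "(\<Sum>r<M. norm (a r)) \<le> 2 * real N"
proof -
  define t where "t r = 2 * pi * real r / real M" for r :: nat
  define J where "J = {0..<int N}"
  define S where "S u = (\<Sum>j\<in>J. cis (of_int j * u))" for u
  \<comment> \<open>The Fejer kernel is \<open>(norm (S u))\<^sup>2 / N\<close>, so this is the
    kernel announced above at the grid points, with \<open>1 / M\<close> turning the sum into a
    mean.\<close>
  define a where "a r = complex_of_real (2 / real M * sin (real N * t r) * (norm (S (t r)))\<^sup>2)" for r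
  have M: "M > 0" using assms by simp
  have S2: "complex_of_real ((norm (S u))\<^sup>2) = (\<Sum>j\<in>J. \<Sum>l\<in>J. cis (of_int (j - l) * u))" for u
  proof -
    have "complex_of_real ((norm (S u))\<^sup>2) = S u * cnj (S u)"
      by (rule complex_norm_square)
    also have "\<dots> = (\<Sum>j\<in>J. \<Sum>l\<in>J. cis (of_int j * u) * cis (- (of_int l * u)))"
      by (simp add: S_def sum_product cis_cnj)
    also have "\<dots> = (\<Sum>j\<in>J. \<Sum>l\<in>J. cis (of_int (j - l) * u))"
      by (simp add: cis_mult algebra_simps)
    finally show ?thesis .
  qed
  have orth: "(\<Sum>r<M. cis (of_int p * t r)) = (if p = 0 then of_nat M else 0)" if "\<bar>p\<bar> < int M" for p
    using sum_cis_equidistant[OF that] by (simp add: t_def)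
  have "(\<Sum>r<M. a r * cis (of_int k * t r)) = \<i> * of_int k" if k: "\<bar>k\<bar> < int N" for k
  proof -
    let ?N = "int N"
    have sin: "complex_of_real (sin x) = (cis x - cis (- x)) / (2 * \<i>)" for x
      by (simp add: complex_eq_iff)
    have c: "complex_of_real (2 / real M) * (z / (2 * \<i>)) = z / (\<i> * of_nat M)" for z
    proof -
      have "complex_of_real (2 / real M) * (z / (2 * \<i>)) = (2 * z) / (2 * (\<i> * of_nat M))"
        by (simp add: mult_ac)
      then show ?thesis by (simp only: mult_divide_mult_cancel_left_if) simp
    qed
    have "a r * cis (of_int k * t r) = (\<Sum>j\<in>J. \<Sum>l\<in>J.
        (cis (of_int (k + ?N + j - l) * t r) - cis (of_int (k - ?N + j - l) * t r)) / (\<i> * of_nat M))" for r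
    proof -
      have "a r * cis (of_int k * t r) = (cis (real N * t r) - cis (- (real N * t r))) / (\<i> * of_nat M)
          * (\<Sum>j\<in>J. \<Sum>l\<in>J. cis (of_int (j - l) * t r)) * cis (of_int k * t r)"
        unfolding a_def S2[symmetric] of_real_mult sin c by simp
      also have "\<dots> = (\<Sum>j\<in>J. \<Sum>l\<in>J. (cis (real N * t r) - cis (- (real N * t r))) / (\<i> * of_nat M)
          * cis (of_int (j - l) * t r) * cis (of_int k * t r))"
        by (simp add: sum_distrib_left sum_distrib_right)
      also have "\<dots> = (\<Sum>j\<in>J. \<Sum>l\<in>J.
        (cis (of_int (k + ?N + j - l) * t r) - cis (of_int (k - ?N + j - l) * t r)) / (\<i> * of_nat M))"
        by (intro sum.cong refl) (simp add: left_diff_distrib diff_divide_distrib mult.assoc cis_mult, simp add: algebra_simps)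
      finally show ?thesis .
    qed
    then have "(\<Sum>r<M. a r * cis (of_int k * t r)) = (\<Sum>r<M. \<Sum>j\<in>J. \<Sum>l\<in>J.
        (cis (of_int (k + ?N + j - l) * t r) - cis (of_int (k - ?N + j - l) * t r)) / (\<i> * of_nat M))"
      by simp
    also have "\<dots> = (\<Sum>j\<in>J. \<Sum>r<M. \<Sum>l\<in>J. 
        (cis (of_int (k + ?N + j - l) * t r) - cis (of_int (k - ?N + j - l) * t r)) / (\<i> * of_nat M))"
      by (rule sum.swap)
    also have "\<dots> = (\<Sum>j\<in>J. \<Sum>l\<in>J. \<Sum>r<M.
        (cis (of_int (k + ?N + j - l) * t r) - cis (of_int (k - ?N + j - l) * t r)) / (\<i> * of_nat M))"
      by (intro sum.cong refl sum.swap)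
    also have "\<dots> = (\<Sum>j\<in>J. \<Sum>l\<in>J. ((if l - j = k + ?N then 1 else 0) - (if l - j = k - ?N then 1 else 0)) / \<i>)"
    proof (intro sum.cong refl)
      fix j l assume jl: "j \<in> J" "l \<in> J"
      \<comment> \<open>Here \<open>3 * N \<le> M\<close> enters: the product with the exponential
        has frequencies below \<open>3 * N\<close>, so the grid does not alias them.\<close>
      have "\<bar>k + ?N + j - l\<bar> < int M" "\<bar>k - ?N + j - l\<bar> < int M"
        using jl k assms by (auto simp: J_def)
      then show "(\<Sum>r<M. (cis (of_int (k + ?N + j - l) * t r) - cis (of_int (k - ?N + j - l) * t r)) / (\<i> * of_nat M))
        = ((if l - j = k + ?N then 1 else 0) - (if l - j = k - ?N then 1 else 0)) / \<i>"
        using M unfolding sum_divide_distrib[symmetric] sum_subtractf by (simp only: orth) auto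
    qed
    also have "\<dots> = (of_int (max 0 (?N - \<bar>k + ?N\<bar>)) - of_int (max 0 (?N - \<bar>k - ?N\<bar>))) / \<i>"
      by (simp only: sum_divide_distrib[symmetric] sum_subtractf J_def count_int_differences)
    also have "\<dots> = of_int (max 0 (?N - \<bar>k + ?N\<bar>) - max 0 (?N - \<bar>k - ?N\<bar>)) / \<i>"
      by simp
    \<comment> \<open>Two tents of height \<open>N\<close> centred at \<open>-N\<close> and
      \<open>N\<close>: their difference is linear between the centres. Dividing \<open>- k\<close>
      by \<open>\<i>\<close> gives the derivative factor.\<close>
    also have "max 0 (?N - \<bar>k + ?N\<bar>) - max 0 (?N - \<bar>k - ?N\<bar>) = - k"
      using k by (auto simp: max_def)
    finally show ?thesis by simp
  qed
  moreover have "(\<Sum>r<M. norm (a r)) \<le> 2 * real N"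
  proof -
    \<comment> \<open>Parseval on the grid: the mean of the squared modulus of \<open>S\<close> is
      \<open>N\<close>. With the sine bounded by 1 this gives the total mass.\<close>
    have "complex_of_real (\<Sum>r<M. (norm (S (t r)))\<^sup>2) = (\<Sum>r<M. \<Sum>j\<in>J. \<Sum>l\<in>J. cis (of_int (j - l) * t r))"
      by (simp only: of_real_sum S2)
    also have "\<dots> = (\<Sum>j\<in>J. \<Sum>r<M. \<Sum>l\<in>J. cis (of_int (j - l) * t r))"
      by (rule sum.swap)
    also have "\<dots> = (\<Sum>j\<in>J. \<Sum>l\<in>J. \<Sum>r<M. cis (of_int (j - l) * t r))"
      by (intro sum.cong refl sum.swap)
    also have "\<dots> = (\<Sum>j\<in>J. \<Sum>l\<in>J. if j = l then of_nat M else 0)"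
    proof (intro sum.cong refl)
      fix j l assume jl: "j \<in> J" "l \<in> J"
      then have "\<bar>j - l\<bar> < int M" using assms by (auto simp: J_def)
      then show "(\<Sum>r<M. cis (of_int (j - l) * t r)) = (if j = l then of_nat M else 0)"
        by (simp only: orth) simp
    qed
    also have "\<dots> = of_nat (N * M)" by (simp add: J_def)
    finally have S_sum: "(\<Sum>r<M. (norm (S (t r)))\<^sup>2) = real (N * M)"
      using of_real_eq_iff by (metis of_real_of_nat_eq)
    have "(\<Sum>r<M. norm (a r)) \<le> (\<Sum>r<M. 2 / real M * (norm (S (t r)))\<^sup>2)"
      unfolding a_def norm_of_real abs_mult
      by (intro sum_mono) (auto intro!: divide_right_mono mult_right_mono)
    also have "\<dots> = 2 * real N"
      unfolding sum_distrib_left[symmetric] S_sum using M by simp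
    finally show ?thesis .
  qed
  ultimately show thesis
    using that[of a] by (simp add: t_def)
qed

lemma cis_equidistant_mod:
  fixes k :: int
  assumes "M > 0"
  shows "cis (of_int k * (2 * pi * real (n mod M) / real M)) = cis (of_int k * (2 * pi * real n / real M))"
proof -
  have "real n = real (n mod M) + real M * real (n div M)"
    by (metis mod_mult_div_eq of_nat_add of_nat_mult)
  then have "2 * pi * real n / real M = 2 * pi * real (n mod M) / real M + 2 * pi * real (n div M)"
    using assms by (simp add: field_simps)
  then have "of_int k * (2 * pi * real n / real M)
      = of_int k * (2 * pi * real (n mod M) / real M) + 2 * pi * of_int (k * int (n div M))"
    by (simp add: distrib_left)
  then show ?thesis by (simp only: cis_mult[symmetric] cis_multiple_2pi[OF Ints_of_int] mult_1_right)
qed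

text \<open>Pairs a cyclic convolution with a function \<open>g\<close>. A character as
  \<open>g\<close> gives multiplicativity, and \<open>g = 1\<close> gives submultiplicativity of the
  total mass.\<close>

lemma sum_shifted_mod:
  fixes x :: "nat \<Rightarrow> nat \<Rightarrow> 'a::comm_semiring_0"
  assumes "M > 0"
  shows "(\<Sum>r<M. (\<Sum>p<M. \<Sum>q<M. if (p + q) mod M = r then x p q else 0) * g r)
    = (\<Sum>p<M. \<Sum>q<M. x p q * g ((p + q) mod M))"
proof -
  have "(\<Sum>r<M. (\<Sum>p<M. \<Sum>q<M. if (p + q) mod M = r then x p q else 0) * g r)
      = (\<Sum>r<M. \<Sum>p<M. \<Sum>q<M. if (p + q) mod M = r then x p q * g r else 0)"
    by (simp add: sum_distrib_right if_distrib[of "\<lambda>z. z * _"] cong: if_cong)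
  also have "\<dots> = (\<Sum>p<M. \<Sum>r<M. \<Sum>q<M. if (p + q) mod M = r then x p q * g r else 0)"
    by (rule sum.swap)
  also have "\<dots> = (\<Sum>p<M. \<Sum>q<M. \<Sum>r<M. if (p + q) mod M = r then x p q * g r else 0)"
    by (intro sum.cong refl sum.swap)
  also have "\<dots> = (\<Sum>p<M. \<Sum>q<M. x p q * g ((p + q) mod M))"
    using assms by (intro sum.cong refl) simp
  finally show ?thesis .
qed

text \<open>The weights are the exponential series of the cyclic convolution operator that acts as differentiation.
  The point is that the bound \<open>B\<close> does not depend on the shift \<open>u\<close>.\<close>
lemma discrete_shift_weights:
  fixes N M :: nat and h :: real
  assumes "3 * N \<le> M" "0 < N" "0 \<le> h"
  obtains A :: "real \<Rightarrow> nat \<Rightarrow> complex" and B :: "nat \<Rightarrow> real" where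
    "\<And>u k. \<bar>u\<bar> \<le> h \<Longrightarrow> \<bar>k\<bar> < int N \<Longrightarrow>
       (\<Sum>r<M. A u r * cis (of_int k * (2 * pi * real r / real M))) = cis (of_int k * u)"
    "\<And>u r. \<bar>u\<bar> \<le> h \<Longrightarrow> r < M \<Longrightarrow> norm (A u r - of_bool (r = 0)) \<le> B r - of_bool (r = 0)"
    "(\<Sum>r<M. B r) \<le> exp (2 * real N * h)"
proof -
  obtain a :: "nat \<Rightarrow> complex" where
    a: "\<And>k. \<bar>k\<bar> < int N \<Longrightarrow> (\<Sum>r<M. a r * cis (of_int k * (2 * pi * real r / real M))) = \<i> * of_int k"
    and a_norm: "(\<Sum>r<M. norm (a r)) \<le> 2 * real N"
    using discrete_Bernstein_weights[OF assms(1,2)] by blast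
  define t where "t r = 2 * pi * real r / real M" for r :: nat
  have M: "M > 0" using assms by simp
  \<comment> \<open>The \<open>n\<close>-th cyclic convolution power of \<open>a\<close>, starting
    from the unit mass at \<open>0\<close>. It acts on the admissible exponentials as the
    \<open>n\<close>-th derivative.\<close>
  define c :: "nat \<Rightarrow> nat \<Rightarrow> complex" where
    "c = rec_nat (\<lambda>r. of_bool (r = 0)) (\<lambda>n w r. \<Sum>p<M. \<Sum>q<M. if (p + q) mod M = r then a p * w q else 0)"
  have c_0: "c 0 r = of_bool (r = 0)" for r by (simp add: c_def)
  have c_Suc: "c (Suc n) r = (\<Sum>p<M. \<Sum>q<M. if (p + q) mod M = r then a p * c n q else 0)" for n r
    unfolding c_def by simp
  have c_cis: "(\<Sum>r<M. c n r * cis (of_int k * t r)) = (\<i> * of_int k) ^ n" if k: "\<bar>k\<bar> < int N" for n k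
  proof (induction n)
    case 0
    have "(\<Sum>r<M. c 0 r * cis (of_int k * t r)) = (\<Sum>r<M. if r = 0 then 1 else 0)"
      by (intro sum.cong) (auto simp: c_0 t_def)
    then show ?case using M by simp
  next
    case (Suc n)
    have add: "cis (of_int k * t ((p + q) mod M)) = cis (of_int k * t p) * cis (of_int k * t q)" for p q
      unfolding t_def cis_equidistant_mod[OF M] by (simp add: cis_mult algebra_simps add_divide_distrib)
    have "(\<Sum>r<M. c (Suc n) r * cis (of_int k * t r))
        = (\<Sum>p<M. \<Sum>q<M. a p * c n q * cis (of_int k * t ((p + q) mod M)))"
      unfolding c_Suc by (rule sum_shifted_mod[OF M])
    also have "\<dots> = (\<Sum>p<M. a p * cis (of_int k * t p)) * (\<Sum>q<M. c n q * cis (of_int k * t q))"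
      by (simp add: add sum_product mult_ac)
    also have "\<dots> = (\<i> * of_int k) ^ Suc n"
      using a[OF k] Suc by (simp add: t_def)
    finally show ?case .
  qed
  have c_norm: "(\<Sum>r<M. norm (c n r)) \<le> (2 * real N) ^ n" for n
  proof (induction n)
    case 0
    have "(\<Sum>r<M. norm (c 0 r)) = (\<Sum>r<M. if r = 0 then 1 else 0)"
      by (intro sum.cong) (auto simp: c_0)
    then show ?case using M by simp
  next
    case (Suc n)
    have "(\<Sum>r<M. norm (c (Suc n) r))
        \<le> (\<Sum>r<M. (\<Sum>p<M. \<Sum>q<M. if (p + q) mod M = r then norm (a p) * norm (c n q) else 0) * 1)"
      unfolding c_Suc mult_1_right
      by (intro sum_mono sum_norm_le) (auto simp: norm_mult)
    also have "\<dots> = (\<Sum>p<M. norm (a p)) * (\<Sum>q<M. norm (c n q))"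
      by (subst sum_shifted_mod[OF M]) (simp add: sum_product)
    also have "\<dots> \<le> (2 * real N) * (2 * real N) ^ n"
      by (intro mult_mono a_norm Suc) (auto intro: sum_nonneg)
    finally show ?case by simp
  qed
  have c_norm1: "norm (c n r) \<le> (2 * real N) ^ n" if "r < M" for n r
    using that by (intro order_trans[OF _ c_norm] member_le_sum) auto
  \<comment> \<open>Taylor's formula writes translation by \<open>u\<close> as the exponential of
    \<open>u\<close> times differentiation. \<open>B\<close> takes norms of the coefficients and the
    largest shift \<open>h\<close>, so it serves all \<open>u\<close> at once.\<close>
  define A where "A u r = (\<Sum>n. of_real (inverse (fact n) * u ^ n) * c n r)" for u r
  define B where "B r = (\<Sum>n. inverse (fact n) * h ^ n * norm (c n r))" for r
  have exp_sum: "summable (\<lambda>n. inverse (fact n) * (2 * real N * h) ^ n)"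
    using summable_exp_generic[of "2 * real N * h"] by simp
  have B_sum: "summable (\<lambda>n. inverse (fact n) * h ^ n * norm (c n r))" if "r < M" for r
  proof (rule summable_comparison_test'[OF exp_sum])
    fix n
    have "norm (c n r) * h ^ n \<le> (2 * real N) ^ n * h ^ n"
      using assms(3) c_norm1[OF that] by (intro mult_right_mono) auto
    then show "norm (inverse (fact n) * h ^ n * norm (c n r)) \<le> inverse (fact n) * (2 * real N * h) ^ n"
      using assms(3) by (simp add: mult_ac power_mult_distrib divide_simps)
  qed
  have A_le: "norm (of_real (inverse (fact n) * u ^ n) * c n r) \<le> inverse (fact n) * h ^ n * norm (c n r)"
    if "\<bar>u\<bar> \<le> h" for u n r
  proof -
    have "\<bar>u\<bar> ^ n \<le> h ^ n" using that by (intro power_mono) auto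
    then have "\<bar>inverse (fact n) * u ^ n\<bar> \<le> inverse (fact n) * h ^ n"
      by (simp add: abs_mult power_abs)
    then show ?thesis
      unfolding norm_mult norm_of_real by (intro mult_right_mono) auto
  qed
  have A_sum: "summable (\<lambda>n. of_real (inverse (fact n) * u ^ n) * c n r)" if "\<bar>u\<bar> \<le> h" "r < M" for u r
    using A_le[OF that(1)] by (intro summable_comparison_test'[OF B_sum[OF that(2)]])
  show thesis
  proof
    fix u :: real and k :: int assume u: "\<bar>u\<bar> \<le> h" and k: "\<bar>k\<bar> < int N"
    have "(\<Sum>r<M. A u r * cis (of_int k * t r))
        = (\<Sum>r<M. \<Sum>n. of_real (inverse (fact n) * u ^ n) * c n r * cis (of_int k * t r))"
      unfolding A_def by (intro sum.cong refl suminf_mult2 A_sum[OF u]) auto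
    also have "\<dots> = (\<Sum>n. \<Sum>r<M. of_real (inverse (fact n) * u ^ n) * c n r * cis (of_int k * t r))"
      by (intro suminf_sum[symmetric] summable_mult2 A_sum[OF u]) auto
    also have "\<dots> = (\<Sum>n. of_real (inverse (fact n) * u ^ n) * (\<i> * of_int k) ^ n)"
      by (simp add: mult.assoc c_cis[OF k] flip: sum_distrib_left)
    also have "\<dots> = exp (\<i> * of_real (of_int k * u))"
      by (simp add: exp_def scaleR_conv_of_real power_mult_distrib mult_ac)
    finally show "(\<Sum>r<M. A u r * cis (of_int k * (2 * pi * real r / real M))) = cis (of_int k * u)"
      by (simp add: cis_conv_exp t_def)
  next
    fix u :: real and r assume u: "\<bar>u\<bar> \<le> h" and r: "r < M"
    let ?f = "\<lambda>n. of_real (inverse (fact n) * u ^ n) * c n r"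
    let ?g = "\<lambda>n. inverse (fact n) * h ^ n * norm (c n r)"
    \<comment> \<open>In both series the term \<open>n = 0\<close> is the unit mass at
      \<open>0\<close>. Removing it leaves tails that are compared term by term.\<close>
    have "A u r - of_bool (r = 0) = (\<Sum>n. ?f (Suc n))"
      using suminf_split_head[OF A_sum[OF u r]] by (simp add: A_def c_0)
    moreover have "B r - of_bool (r = 0) = (\<Sum>n. ?g (Suc n))"
      using suminf_split_head[OF B_sum[OF r]] by (simp add: B_def c_0)
    moreover have "norm (\<Sum>n. ?f (Suc n)) \<le> (\<Sum>n. ?g (Suc n))"
      using B_sum[OF r] A_le[OF u] by (intro norm_suminf_le summable_ignore_initial_segment[where k=1, simplified] )
    ultimately show "norm (A u r - of_bool (r = 0)) \<le> B r - of_bool (r = 0)"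
      by simp
  next
    have "(\<Sum>r<M. B r) = (\<Sum>n. \<Sum>r<M. inverse (fact n) * h ^ n * norm (c n r))"
      unfolding B_def by (intro suminf_sum[symmetric] B_sum) auto
    also have "\<dots> \<le> (\<Sum>n. inverse (fact n) * (2 * real N * h) ^ n)"
    proof (intro suminf_le exp_sum summable_sum B_sum)
      fix n
      have "(\<Sum>r<M. inverse (fact n) * h ^ n * norm (c n r)) = inverse (fact n) * h ^ n * (\<Sum>r<M. norm (c n r))"
        by (simp add: sum_distrib_left)
      also have "\<dots> \<le> inverse (fact n) * h ^ n * (2 * real N) ^ n"
        using assms(3) by (intro mult_left_mono c_norm) auto
      finally show "(\<Sum>r<M. inverse (fact n) * h ^ n * norm (c n r)) \<le> inverse (fact n) * (2 * real N * h) ^ n"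
        by (simp add: power_mult_distrib mult_ac)
    qed auto
    also have "\<dots> = exp (2 * real N * h)"
      by (simp add: exp_def)
    finally show "(\<Sum>r<M. B r) \<le> exp (2 * real N * h)" .
  qed
qed

section \<open>Convexity of powers and perturbation of products\<close>

lemma powr_above_tangent:
  fixes x y q :: real
  assumes "1 \<le> q" "0 \<le> x" "0 < y"
  shows "y powr q + q * y powr (q - 1) * (x - y) \<le> x powr q"
proof (cases "x = 0")
  case True
  have "y powr q = y powr (q - 1) * y" using assms by (simp add: powr_diff)
  then have "y powr q + q * y powr (q - 1) * (x - y) = (1 - q) * y powr q"
    using True by (simp add: algebra_simps)
  also have "\<dots> \<le> 0" using assms by (intro mult_nonpos_nonneg) auto
  finally show ?thesis using True by simp
next
  case False
  \<comment> \<open>Convexity is applied on the open half-line, which is why \<open>x = 0\<close> is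
    treated separately.\<close>
  have "(\<lambda>x. x powr q) x - (\<lambda>x. x powr q) y \<ge> q * y powr (q - 1) * (x - y)"
  proof (rule convex_on_imp_above_tangent)
    show "convex_on {0<..} (\<lambda>x. x powr q)" using assms by (intro powr_convex)
    show "((\<lambda>x. x powr q) has_real_derivative q * y powr (q - 1)) (at y within {0<..})"
      using assms by (auto intro!: derivative_eq_intros simp: has_field_derivative_at_within)
  qed (use assms False in \<open>auto simp: interior_open\<close>)
  then show ?thesis by simp
qed

text \<open>Jensen's inequality for weights whose total \<open>W\<close> is not normalized, whence
  the factor \<open>W powr (q - 1)\<close>.\<close>

lemma weighted_sum_powr_le:
  fixes w b :: "'a \<Rightarrow> real"
  assumes "1 \<le> q" "finite I" "\<And>i. i \<in> I \<Longrightarrow> 0 \<le> w i" "\<And>i. i \<in> I \<Longrightarrow> 0 \<le> b i"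
  shows "(\<Sum>i\<in>I. w i * b i) powr q \<le> (\<Sum>i\<in>I. w i) powr (q - 1) * (\<Sum>i\<in>I. w i * b i powr q)"
proof (cases "(\<Sum>i\<in>I. w i * b i) = 0")
  case True
  then show ?thesis using assms by (auto intro!: mult_nonneg_nonneg sum_nonneg)
next
  case False
  define W where "W = (\<Sum>i\<in>I. w i)"
  define y where "y = (\<Sum>i\<in>I. w i * b i) / W"
  have pos: "(\<Sum>i\<in>I. w i * b i) > 0"
    using False assms by (simp add: less_le sum_nonneg)
  have "W \<noteq> 0"
    using False assms by (auto simp: W_def sum_nonneg_eq_0_iff)
  moreover have "W \<ge> 0" using assms by (simp add: W_def sum_nonneg)
  ultimately have W: "W > 0" by simp
  then have y: "y > 0" using pos by (simp add: y_def)
  have wb: "(\<Sum>i\<in>I. w i * b i) = (\<Sum>i\<in>I. w i) * y" using W by (simp add: y_def W_def)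
  \<comment> \<open>The tangent at the weighted mean \<open>y\<close> is summed over all
    \<open>i\<close>; its linear terms cancel.\<close>
  have "W * y powr q = (\<Sum>i\<in>I. w i * (y powr q + q * y powr (q - 1) * (b i - y)))"
  proof -
    have "(\<Sum>i\<in>I. w i * (y powr q + q * y powr (q - 1) * (b i - y)))
        = (\<Sum>i\<in>I. w i * y powr q + q * y powr (q - 1) * (w i * b i) - q * y powr (q - 1) * y * w i)"
      by (intro sum.cong) (auto simp: algebra_simps)
    also have "\<dots> = W * y powr q + q * y powr (q - 1) * (W * y) - q * y powr (q - 1) * y * W"
      by (simp only: sum.distrib sum_subtractf wb W_def flip: sum_distrib_left sum_distrib_right)
    finally show ?thesis by simp
  qed
  also have "\<dots> \<le> (\<Sum>i\<in>I. w i * b i powr q)"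
    using assms y by (intro sum_mono mult_left_mono powr_above_tangent) auto
  finally have "W powr (q - 1) * (W * y powr q) \<le> W powr (q - 1) * (\<Sum>i\<in>I. w i * b i powr q)"
    by (intro mult_left_mono) auto
  moreover have "W powr (q - 1) * (W * y powr q) = (W * y) powr q"
    using W y by (simp add: powr_mult powr_diff)
  ultimately show ?thesis using W by (simp add: W_def y_def)
qed

lemma add_powr_le:
  fixes x y q :: real
  assumes "1 \<le> q" "0 \<le> x" "0 \<le> y"
  shows "(x + y) powr q \<le> 2 powr (q - 1) * (x powr q + y powr q)"
  using weighted_sum_powr_le[of q "UNIV :: bool set" "\<lambda>_. 1" "\<lambda>c. if c then x else y"] assms
  by (simp add: UNIV_bool add.commute)

text \<open>Carries one-dimensional deviations over to tensor products. Replacing one factor at a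
  time produces on the left the same terms that make up the right-hand side, with norms in place of
  majorants.\<close>

lemma norm_prod_diff_le:
  fixes a :: "'a \<Rightarrow> 'b::real_normed_field" and b B :: "'a \<Rightarrow> real"
  assumes "finite I" "\<And>i. i \<in> I \<Longrightarrow> 0 \<le> b i"
    and "\<And>i. i \<in> I \<Longrightarrow> norm (a i - of_real (b i)) \<le> B i - b i"
  shows "norm ((\<Prod>i\<in>I. a i) - of_real (\<Prod>i\<in>I. b i)) \<le> (\<Prod>i\<in>I. B i) - (\<Prod>i\<in>I. b i)"
  using assms
proof (induction I rule: finite_induct)
  case (insert i I)
  let ?a = "\<Prod>i\<in>I. a i" and ?b = "\<Prod>i\<in>I. b i" and ?B = "\<Prod>i\<in>I. B i"
  have IH: "norm (?a - of_real ?b) \<le> ?B - ?b" using insert by auto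
  have b: "0 \<le> ?b" using insert by (auto intro: prod_nonneg)
  have "norm ?a \<le> norm (?a - of_real ?b) + norm (of_real ?b :: 'b)"
    by (metis diff_add_cancel norm_triangle_ineq)
  also have "norm (of_real ?b :: 'b) = ?b" using b by (simp only: norm_of_real abs_of_nonneg)
  finally have a: "norm ?a \<le> ?B" using IH by simp
  have "a i * ?a - of_real (b i * ?b) = (a i - of_real (b i)) * ?a + of_real (b i) * (?a - of_real ?b)"
    by (simp add: algebra_simps)
  also have "norm \<dots> \<le> norm (a i - of_real (b i)) * norm ?a + b i * norm (?a - of_real ?b)"
    using insert.prems by (intro order_trans[OF norm_triangle_ineq]) (simp add: norm_mult)
  also have "\<dots> \<le> (B i - b i) * ?B + b i * (?B - ?b)"
    using insert.prems IH a order_trans[OF norm_ge_zero insert.prems(2)[of i]]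
    by (intro add_mono mult_mono) auto
  finally show ?case using insert.hyps by (simp add: algebra_simps)
qed simp

subsection \<open>Trigonometric polynomials on grid cells\<close>

definition grid_index :: "('d::finite \<Rightarrow> nat) \<Rightarrow> ('d \<Rightarrow> nat) set" where
  "grid_index M = Pi\<^sub>E UNIV (\<lambda>j. {..<M j})"

definition grid_point :: "('d::finite \<Rightarrow> nat) \<Rightarrow> ('d \<Rightarrow> nat) \<Rightarrow> real^'d" where
  "grid_point M \<kappa> = (\<chi> j. 2 * pi * real (\<kappa> j) / real (M j))"

text \<open>Cells are closed so that continuous functions attain their extrema on them; the price is
  that neighbours share faces.\<close>

definition grid_cell :: "('d::finite \<Rightarrow> nat) \<Rightarrow> ('d \<Rightarrow> nat) \<Rightarrow> (real^'d) set" where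
  "grid_cell M \<kappa> = cbox (grid_point M \<kappa>) (grid_point M (\<lambda>j. Suc (\<kappa> j)))"

lemma finite_grid_index [simp]: "finite (grid_index M)"
  by (simp add: grid_index_def finite_PiE)

lemma mem_grid_index: "\<kappa> \<in> grid_index M \<longleftrightarrow> (\<forall>j. \<kappa> j < M j)"
  by (auto simp: grid_index_def PiE_def)

lemma cis_sum: "finite I \<Longrightarrow> cis (\<Sum>i\<in>I. x i) = (\<Prod>i\<in>I. cis (x i))"
  by (induction I rule: finite_induct) (simp_all flip: cis_mult)

lemma trig_polysE:
  assumes "f \<in> trig_polys Q"
  obtains c where "\<And>x. f x = (\<Sum>k\<in>Q. c k * cis (\<Sum>j\<in>UNIV. real_of_int (k j) * x $ j))"
  using assms unfolding trig_polys_def cis_conv_exp by blast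

lemma trig_poly_grid_point_mod:
  assumes f: "f \<in> trig_polys Q" and M: "\<And>j. 0 < M j"
  shows "f (grid_point M (\<lambda>j. \<kappa> j mod M j)) = f (grid_point M \<kappa>)"
proof -
  obtain c where "\<And>x. f x = (\<Sum>k\<in>Q. c k * cis (\<Sum>j\<in>UNIV. real_of_int (k j) * x $ j))"
    using trig_polysE[OF f] by blast
  then show ?thesis
    by (simp only: cis_sum finite grid_point_def vec_lambda_beta cis_equidistant_mod[OF M])
qed

text \<open>Translation by \<open>\<rho>\<close> modulo \<open>M\<close> permutes the grid, and
  \<open>f\<close> is periodic.\<close>

lemma trig_poly_grid_sum_shift:
  fixes f :: "real^'d::finite \<Rightarrow> complex" and g :: "complex \<Rightarrow> real"
  assumes f: "f \<in> trig_polys Q" and M: "\<And>j. 0 < M j"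
  shows "(\<Sum>\<kappa>\<in>grid_index M. g (f (grid_point M (\<lambda>j. \<kappa> j + \<rho> j)))) = (\<Sum>\<kappa>\<in>grid_index M. g (f (grid_point M \<kappa>)))"
proof -
  let ?s = "\<lambda>\<kappa> j. (\<kappa> j + \<rho> j) mod M j"
  have inj: "inj_on ?s (grid_index M)"
  proof (intro inj_onI ext)
    fix \<kappa> \<kappa>' j assume *: "\<kappa> \<in> grid_index M" "\<kappa>' \<in> grid_index M" "?s \<kappa> = ?s \<kappa>'"
    have "[\<kappa> j + \<rho> j = \<kappa>' j + \<rho> j] (mod M j)"
      unfolding cong_def by (rule fun_cong[OF *(3)])
    then have "[\<kappa> j = \<kappa>' j] (mod M j)"
      by (simp only: cong_add_rcancel_nat)
    then show "\<kappa> j = \<kappa>' j"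
      using * by (simp add: cong_less_modulus_unique_nat mem_grid_index)
  qed
  have "?s ` grid_index M = grid_index M"
    using M by (intro endo_inj_surj inj) (auto simp: mem_grid_index)
  then have "(\<Sum>\<kappa>\<in>grid_index M. g (f (grid_point M \<kappa>))) = (\<Sum>\<kappa>\<in>grid_index M. g (f (grid_point M (?s \<kappa>))))"
    using sum.reindex[OF inj, of "\<lambda>\<kappa>. g (f (grid_point M \<kappa>))"] by simp
  then show ?thesis
    by (simp only: trig_poly_grid_point_mod[OF f M])
qed

text \<open>The tensor product of the one-dimensional shift weights, with the largest shift
  \<open>2 * pi / M j\<close> inside a cell. The kernel \<open>E\<close> is fixed before
  \<open>Q\<close>, \<open>f\<close>, the cell and the point \<open>y\<close>, which later allows an
  arbitrary point in every cell.\<close>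

lemma grid_shift_weights:
  fixes N M :: "'d::finite \<Rightarrow> nat"
  assumes MN: "\<And>j. 3 * N j \<le> M j" "\<And>j. 0 < N j"
  obtains E :: "('d \<Rightarrow> nat) \<Rightarrow> real" where
    "\<And>\<rho>. \<rho> \<in> grid_index M \<Longrightarrow> 0 \<le> E \<rho>"
    "(\<Sum>\<rho>\<in>grid_index M. E \<rho>) \<le> exp (\<Sum>j\<in>UNIV. 4 * pi * real (N j) / real (M j)) - 1"
    "\<And>Q f \<kappa> y. (\<And>k j. k \<in> Q \<Longrightarrow> \<bar>k j\<bar> < int (N j)) \<Longrightarrow> f \<in> trig_polys Q \<Longrightarrow> y \<in> grid_cell M \<kappa> \<Longrightarrow>
      norm (f y - f (grid_point M \<kappa>)) \<le> (\<Sum>\<rho>\<in>grid_index M. E \<rho> * norm (f (grid_point M (\<lambda>j. \<kappa> j + \<rho> j))))"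
proof -
  have M: "0 < M j" for j using MN[of j] by linarith
  define P where "P j A B \<longleftrightarrow> (\<forall>u k. \<bar>u\<bar> \<le> 2 * pi / real (M j) \<longrightarrow> \<bar>k\<bar> < int (N j) \<longrightarrow>
       (\<Sum>r<M j. A u r * cis (of_int k * (2 * pi * real r / real (M j)))) = cis (of_int k * u)) \<and>
    (\<forall>u r. \<bar>u\<bar> \<le> 2 * pi / real (M j) \<longrightarrow> r < M j \<longrightarrow> norm (A u r - of_bool (r = 0)) \<le> B r - of_bool (r = 0)) \<and>
    (\<Sum>r<M j. B r) \<le> exp (2 * real (N j) * (2 * pi / real (M j)))" for j A B
  have "\<exists>A B. P j A B" for j
    unfolding P_def by (rule discrete_shift_weights[OF MN, of "2 * pi / real (M j)" j]) (simp, blast)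
  then obtain A B where P: "\<And>j. P j (A j) (B j)" by metis
  have A: "\<bar>u\<bar> \<le> 2 * pi / real (M j) \<Longrightarrow> \<bar>k\<bar> < int (N j) \<Longrightarrow>
      (\<Sum>r<M j. A j u r * cis (of_int k * (2 * pi * real r / real (M j)))) = cis (of_int k * u)"
    and AB: "\<bar>u\<bar> \<le> 2 * pi / real (M j) \<Longrightarrow> r < M j \<Longrightarrow> norm (A j u r - of_bool (r = 0)) \<le> B j r - of_bool (r = 0)"
    and B: "(\<Sum>r<M j. B j r) \<le> exp (2 * real (N j) * (2 * pi / real (M j)))" for j u k r
    using P[of j] unfolding P_def by blast+
  \<comment> \<open>The shift \<open>u = 0\<close> is admissible, and a bound on a norm is
    nonnegative.\<close>
  have B_ge: "of_bool (r = 0) \<le> B j r" if "r < M j" for j r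
    using order_trans[OF norm_ge_zero AB[of 0 j r]] that by simp
  \<comment> \<open>The unit mass at the zero multi-index, as a product so that
    \<open>norm_prod_diff_le\<close> applies.\<close>
  define D :: "('d \<Rightarrow> nat) \<Rightarrow> real" where "D \<rho> = (\<Prod>j\<in>UNIV. of_bool (\<rho> j = 0))" for \<rho>
  have D_eq: "D \<rho> = of_bool (\<rho> = (\<lambda>_. 0))" for \<rho>
    by (auto simp: D_def fun_eq_iff)
  have zero: "(\<lambda>_. 0) \<in> grid_index M" using M by (simp add: mem_grid_index)
  define E where "E \<rho> = (\<Prod>j\<in>UNIV. B j (\<rho> j)) - D \<rho>" for \<rho>
  show thesis
  proof
    fix \<rho> assume "\<rho> \<in> grid_index M"
    then show "0 \<le> E \<rho>"
      unfolding E_def D_def using B_ge by (simp add: mem_grid_index prod_mono)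
  next
    have "(\<Sum>\<rho>\<in>grid_index M. D \<rho>) = 1"
      using zero by (simp add: D_eq of_bool_def)
    then have "(\<Sum>\<rho>\<in>grid_index M. E \<rho>) = (\<Prod>j\<in>UNIV. \<Sum>r<M j. B j r) - 1"
      by (simp add: E_def sum_subtractf prod_sum_PiE grid_index_def)
    also have "(\<Prod>j\<in>UNIV. \<Sum>r<M j. B j r) \<le> (\<Prod>j\<in>UNIV. exp (2 * real (N j) * (2 * pi / real (M j))))"
      using B by (intro prod_mono conjI sum_nonneg) (auto intro: order_trans[OF _ B_ge])
    also have "\<dots> = exp (\<Sum>j\<in>UNIV. 4 * pi * real (N j) / real (M j))"
      by (simp add: exp_sum mult_ac)
    finally show "(\<Sum>\<rho>\<in>grid_index M. E \<rho>) \<le> exp (\<Sum>j\<in>UNIV. 4 * pi * real (N j) / real (M j)) - 1"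
      by simp
  next
    fix Q and f :: "real^'d \<Rightarrow> complex" and \<kappa> :: "'d \<Rightarrow> nat" and y :: "real^'d"
    assume Q: "\<And>k j. k \<in> Q \<Longrightarrow> \<bar>k j\<bar> < int (N j)" and f: "f \<in> trig_polys Q" and y: "y \<in> grid_cell M \<kappa>"
    obtain c where c: "\<And>x. f x = (\<Sum>k\<in>Q. c k * cis (\<Sum>j\<in>UNIV. real_of_int (k j) * x $ j))"
      using trig_polysE[OF f] by blast
    define u where "u j = y $ j - grid_point M \<kappa> $ j" for j
    have u: "\<bar>u j\<bar> \<le> 2 * pi / real (M j)" for j
    proof -
      have "2 * pi * real (Suc (\<kappa> j)) / real (M j) = 2 * pi * real (\<kappa> j) / real (M j) + 2 * pi / real (M j)"
        by (simp add: algebra_simps add_divide_distrib)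
      moreover have "0 \<le> 2 * pi / real (M j)" by simp
      moreover have "2 * pi * real (\<kappa> j) / real (M j) \<le> y $ j" "y $ j \<le> 2 * pi * real (Suc (\<kappa> j)) / real (M j)"
        using y by (auto simp: grid_cell_def mem_box_cart grid_point_def simp del: of_nat_Suc)
      ultimately show ?thesis
        unfolding u_def grid_point_def vec_lambda_beta by linarith
    qed
    define a where "a \<rho> = (\<Prod>j\<in>UNIV. A j (u j) (\<rho> j))" for \<rho> :: "'d \<Rightarrow> nat"
    have "f y = (\<Sum>k\<in>Q. \<Sum>\<rho>\<in>grid_index M. a \<rho> *
        (c k * cis (\<Sum>j\<in>UNIV. real_of_int (k j) * grid_point M (\<lambda>j. \<kappa> j + \<rho> j) $ j)))"
      unfolding c
    proof (intro sum.cong refl)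
      fix k assume k: "k \<in> Q"
      \<comment> \<open>Each exponential is moved from the corner to \<open>y\<close> one coordinate
        at a time. The frequency bound on \<open>Q\<close> is what makes \<open>A j\<close>
        reproduce the factor exactly.\<close>
      have "cis (\<Sum>j\<in>UNIV. real_of_int (k j) * y $ j)
          = (\<Prod>j\<in>UNIV. cis (real_of_int (k j) * grid_point M \<kappa> $ j) * cis (real_of_int (k j) * u j))"
        by (simp add: cis_sum cis_mult u_def flip: distrib_left)
      also have "\<dots> = (\<Prod>j\<in>UNIV. \<Sum>r<M j. A j (u j) r * cis (real_of_int (k j) * grid_point M (\<lambda>j. \<kappa> j + r) $ j))"
      proof (intro prod.cong refl)
        fix j
        show "cis (real_of_int (k j) * grid_point M \<kappa> $ j) * cis (real_of_int (k j) * u j)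
            = (\<Sum>r<M j. A j (u j) r * cis (real_of_int (k j) * grid_point M (\<lambda>j. \<kappa> j + r) $ j))"
          unfolding A[OF u Q[OF k], symmetric] sum_distrib_left
          by (intro sum.cong refl) (simp add: grid_point_def algebra_simps add_divide_distrib flip: cis_mult)
      qed
      also have "\<dots> = (\<Sum>\<rho>\<in>grid_index M. a \<rho> * cis (\<Sum>j\<in>UNIV. real_of_int (k j) * grid_point M (\<lambda>j. \<kappa> j + \<rho> j) $ j))"
        by (simp add: prod_sum_PiE grid_index_def a_def prod.distrib cis_sum grid_point_def)
      finally show "c k * cis (\<Sum>j\<in>UNIV. real_of_int (k j) * y $ j) = (\<Sum>\<rho>\<in>grid_index M. a \<rho> *
          (c k * cis (\<Sum>j\<in>UNIV. real_of_int (k j) * grid_point M (\<lambda>j. \<kappa> j + \<rho> j) $ j)))"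
        by (simp add: sum_distrib_left mult_ac)
    qed
    also have "\<dots> = (\<Sum>\<rho>\<in>grid_index M. a \<rho> * f (grid_point M (\<lambda>j. \<kappa> j + \<rho> j)))"
      unfolding c sum_distrib_left by (rule sum.swap)
    finally have fy: "f y = (\<Sum>\<rho>\<in>grid_index M. a \<rho> * f (grid_point M (\<lambda>j. \<kappa> j + \<rho> j)))" .
    \<comment> \<open>The corner value becomes a sum over the same shifts, so that the difference
      has the weights \<open>a \<rho> - D \<rho>\<close>.\<close>
    have "f (grid_point M \<kappa>) = (\<Sum>\<rho>\<in>grid_index M. if \<rho> = (\<lambda>_. 0) then f (grid_point M \<kappa>) else 0)"
      using zero by simp
    also have "\<dots> = (\<Sum>\<rho>\<in>grid_index M. of_real (D \<rho>) * f (grid_point M (\<lambda>j. \<kappa> j + \<rho> j)))"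
      by (intro sum.cong) (auto simp: D_eq)
    finally have "f y - f (grid_point M \<kappa>)
        = (\<Sum>\<rho>\<in>grid_index M. (a \<rho> - of_real (D \<rho>)) * f (grid_point M (\<lambda>j. \<kappa> j + \<rho> j)))"
      unfolding fy by (simp add: left_diff_distrib sum_subtractf)
    also have "norm \<dots> \<le> (\<Sum>\<rho>\<in>grid_index M. E \<rho> * norm (f (grid_point M (\<lambda>j. \<kappa> j + \<rho> j))))"
    proof (intro sum_norm_le)
      fix \<rho> assume \<rho>: "\<rho> \<in> grid_index M"
      have "norm (a \<rho> - of_real (D \<rho>)) \<le> E \<rho>"
        unfolding a_def D_def E_def
      proof (rule norm_prod_diff_le)
        fix j
        have "complex_of_real (of_bool (\<rho> j = 0)) = of_bool (\<rho> j = 0)" by simp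
        then show "norm (A j (u j) (\<rho> j) - of_real (of_bool (\<rho> j = 0))) \<le> B j (\<rho> j) - of_bool (\<rho> j = 0)"
          using AB[OF u, of "\<rho> j" j] \<rho> by (simp only: mem_grid_index)
      qed auto
      then show "norm ((a \<rho> - of_real (D \<rho>)) * f (grid_point M (\<lambda>j. \<kappa> j + \<rho> j)))
          \<le> E \<rho> * norm (f (grid_point M (\<lambda>j. \<kappa> j + \<rho> j)))"
        by (simp add: norm_mult mult_right_mono)
    qed
    finally show "norm (f y - f (grid_point M \<kappa>)) \<le> (\<Sum>\<rho>\<in>grid_index M. E \<rho> * norm (f (grid_point M (\<lambda>j. \<kappa> j + \<rho> j))))" .
  qed
qed

text \<open>The bound \<open>3 / 2\<close> leaves the deviation kernel with mass at most
  \<open>1 / 2\<close>; being below 1, it lets deviations be absorbed into the main term.\<close>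

locale fine_grid =
  fixes N M :: "'d::finite \<Rightarrow> nat" and Q :: "('d \<Rightarrow> int) set" and f :: "real^'d \<Rightarrow> complex"
  assumes MN: "\<And>j. 3 * N j \<le> M j" and N_pos: "\<And>j. 0 < N j"
    and fine: "exp (\<Sum>j\<in>UNIV. 4 * pi * real (N j) / real (M j)) \<le> 3 / 2"
    and Q: "\<And>k j. k \<in> Q \<Longrightarrow> \<bar>k j\<bar> < int (N j)"
    and f: "f \<in> trig_polys Q"
begin

lemma M_pos: "0 < M j"
  using MN[of j] N_pos[of j] by linarith

lemma ex_weights:
  obtains E :: "('d \<Rightarrow> nat) \<Rightarrow> real" where
    "\<And>\<rho>. \<rho> \<in> grid_index M \<Longrightarrow> 0 \<le> E \<rho>"
    "(\<Sum>\<rho>\<in>grid_index M. E \<rho>) \<le> 1 / 2"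
    "\<And>\<kappa> y. y \<in> grid_cell M \<kappa> \<Longrightarrow>
      norm (f y - f (grid_point M \<kappa>)) \<le> (\<Sum>\<rho>\<in>grid_index M. E \<rho> * norm (f (grid_point M (\<lambda>j. \<kappa> j + \<rho> j))))"
proof (rule grid_shift_weights[OF MN N_pos])
  fix E :: "('d \<Rightarrow> nat) \<Rightarrow> real"
  assume "\<And>\<rho>. \<rho> \<in> grid_index M \<Longrightarrow> 0 \<le> E \<rho>"
    and "sum E (grid_index M) \<le> exp (\<Sum>j\<in>UNIV. 4 * pi * real (N j) / real (M j)) - 1"
    and "\<And>Q f \<kappa> y. (\<And>k j. k \<in> Q \<Longrightarrow> \<bar>k j\<bar> < int (N j)) \<Longrightarrow> f \<in> trig_polys Q \<Longrightarrow> y \<in> grid_cell M \<kappa> \<Longrightarrow>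
      norm (f y - f (grid_point M \<kappa>)) \<le> (\<Sum>\<rho>\<in>grid_index M. E \<rho> * norm (f (grid_point M (\<lambda>j. \<kappa> j + \<rho> j))))"
  then show thesis using that[of E] fine Q f by force
qed

text \<open>Young's inequality on the cyclic grid: Jensen at each corner, then summation over
  corners, where every shift contributes the same sum. The mass of \<open>E\<close> enters with
  total power \<open>q\<close>.\<close>

lemma sum_powr_diff_le:
  assumes q: "1 \<le> q" and y: "\<And>\<kappa>. \<kappa> \<in> grid_index M \<Longrightarrow> y \<kappa> \<in> grid_cell M \<kappa>"
  shows "(\<Sum>\<kappa>\<in>grid_index M. norm (f (y \<kappa>) - f (grid_point M \<kappa>)) powr q)
    \<le> (1 / 2) powr q * (\<Sum>\<kappa>\<in>grid_index M. norm (f (grid_point M \<kappa>)) powr q)"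
proof -
  obtain E where E: "\<And>\<rho>. \<rho> \<in> grid_index M \<Longrightarrow> 0 \<le> E \<rho>" "(\<Sum>\<rho>\<in>grid_index M. E \<rho>) \<le> 1 / 2"
    "\<And>\<kappa> y. y \<in> grid_cell M \<kappa> \<Longrightarrow>
      norm (f y - f (grid_point M \<kappa>)) \<le> (\<Sum>\<rho>\<in>grid_index M. E \<rho> * norm (f (grid_point M (\<lambda>j. \<kappa> j + \<rho> j))))"
    using ex_weights by blast
  let ?W = "\<Sum>\<rho>\<in>grid_index M. E \<rho>" and ?S = "\<Sum>\<kappa>\<in>grid_index M. norm (f (grid_point M \<kappa>)) powr q"
  have W: "0 \<le> ?W" using E(1) by (rule sum_nonneg)
  have "(\<Sum>\<kappa>\<in>grid_index M. norm (f (y \<kappa>) - f (grid_point M \<kappa>)) powr q)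
      \<le> (\<Sum>\<kappa>\<in>grid_index M. ?W powr (q - 1) *
          (\<Sum>\<rho>\<in>grid_index M. E \<rho> * norm (f (grid_point M (\<lambda>j. \<kappa> j + \<rho> j))) powr q))"
  proof (rule sum_mono)
    fix \<kappa> assume "\<kappa> \<in> grid_index M"
    then have "norm (f (y \<kappa>) - f (grid_point M \<kappa>)) powr q
        \<le> (\<Sum>\<rho>\<in>grid_index M. E \<rho> * norm (f (grid_point M (\<lambda>j. \<kappa> j + \<rho> j)))) powr q"
      using q by (intro powr_mono2 E(3) y) auto
    also have "\<dots> \<le> ?W powr (q - 1) *
          (\<Sum>\<rho>\<in>grid_index M. E \<rho> * norm (f (grid_point M (\<lambda>j. \<kappa> j + \<rho> j))) powr q)"
      using q E(1) by (intro weighted_sum_powr_le) auto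
    finally show "norm (f (y \<kappa>) - f (grid_point M \<kappa>)) powr q \<le> \<dots>" .
  qed
  also have "\<dots> = ?W powr (q - 1) * (\<Sum>\<rho>\<in>grid_index M. \<Sum>\<kappa>\<in>grid_index M.
      E \<rho> * norm (f (grid_point M (\<lambda>j. \<kappa> j + \<rho> j))) powr q)"
    unfolding sum_distrib_left by (rule sum.swap)
  also have "\<dots> = ?W powr (q - 1) * (?W * ?S)"
    by (simp only: trig_poly_grid_sum_shift[OF f M_pos, of "\<lambda>z. norm z powr q"]
        sum_distrib_right flip: sum_distrib_left)
  also have "\<dots> \<le> (1 / 2) powr (q - 1) * (1 / 2 * ?S)"
    using q W E(2) by (intro mult_mono powr_mono2) (auto intro!: sum_nonneg mult_nonneg_nonneg)
  also have "\<dots> = (1 / 2) powr q * ?S"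
    by (simp add: powr_diff)
  finally show ?thesis .
qed

text \<open>Both sides are compared with the sum over the corners, each comparison costing
  \<open>2 powr q\<close>.\<close>

lemma sum_powr_cells_le:
  assumes q: "1 \<le> q" and y: "\<And>\<kappa>. \<kappa> \<in> grid_index M \<Longrightarrow> y \<kappa> \<in> grid_cell M \<kappa>"
    and z: "\<And>\<kappa>. \<kappa> \<in> grid_index M \<Longrightarrow> z \<kappa> \<in> grid_cell M \<kappa>"
  shows "(\<Sum>\<kappa>\<in>grid_index M. norm (f (y \<kappa>)) powr q) \<le> 4 powr q * (\<Sum>\<kappa>\<in>grid_index M. norm (f (z \<kappa>)) powr q)"
proof -
  let ?S = "\<Sum>\<kappa>\<in>grid_index M. norm (f (grid_point M \<kappa>)) powr q"
  have two: "2 powr (q - 1) * (1 / 2) powr q = 1 / 2"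
    by (simp add: powr_diff powr_divide)
  have norm_le: "norm v powr q \<le> 2 powr (q - 1) * (norm w powr q + norm (v - w) powr q)" for v w :: complex
  proof -
    have "norm v \<le> norm w + norm (v - w)"
      by (metis add.commute diff_add_cancel norm_triangle_ineq)
    then have "norm v powr q \<le> (norm w + norm (v - w)) powr q"
      using q by (intro powr_mono2) auto
    also have "\<dots> \<le> 2 powr (q - 1) * (norm w powr q + norm (v - w) powr q)"
      using q by (intro add_powr_le) auto
    finally show ?thesis .
  qed
  have "(\<Sum>\<kappa>\<in>grid_index M. norm (f (y \<kappa>)) powr q) \<le> (\<Sum>\<kappa>\<in>grid_index M. 2 powr (q - 1) *
      (norm (f (grid_point M \<kappa>)) powr q + norm (f (y \<kappa>) - f (grid_point M \<kappa>)) powr q))"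
    by (intro sum_mono norm_le)
  also have "\<dots> \<le> 2 powr (q - 1) * (?S + (1 / 2) powr q * ?S)"
    unfolding sum_distrib_left[symmetric] sum.distrib
    using sum_powr_diff_le[OF q y] by (intro mult_left_mono add_left_mono) auto
  also have "\<dots> = (2 powr (q - 1) + 1 / 2) * ?S"
    by (simp only: two distrib_left distrib_right mult.assoc[symmetric])
  also have "\<dots> \<le> 2 powr q * ?S"
  proof (rule mult_right_mono)
    have "1 \<le> 2 powr q" using q by (intro ge_one_powr_ge_zero) auto
    then show "2 powr (q - 1) + 1 / 2 \<le> 2 powr q" by (simp add: powr_diff)
  qed (auto intro: sum_nonneg)
  finally have *: "(\<Sum>\<kappa>\<in>grid_index M. norm (f (y \<kappa>)) powr q) \<le> 2 powr q * ?S" .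
  have "?S \<le> (\<Sum>\<kappa>\<in>grid_index M. 2 powr (q - 1) *
      (norm (f (z \<kappa>)) powr q + norm (f (z \<kappa>) - f (grid_point M \<kappa>)) powr q))"
    using norm_le[of "f (grid_point M _)" "f (z _)"]
    by (intro sum_mono) (simp only: norm_minus_commute)
  also have "\<dots> \<le> 2 powr (q - 1) * ((\<Sum>\<kappa>\<in>grid_index M. norm (f (z \<kappa>)) powr q) + (1 / 2) powr q * ?S)"
    unfolding sum_distrib_left[symmetric] sum.distrib
    using sum_powr_diff_le[OF q z] by (intro mult_left_mono add_left_mono) auto
  \<comment> \<open>The corner sum returns with coefficient \<open>1 / 2\<close> and is absorbed on
    the left.\<close>
  also have "\<dots> = 2 powr (q - 1) * (\<Sum>\<kappa>\<in>grid_index M. norm (f (z \<kappa>)) powr q) + 1 / 2 * ?S"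
    by (simp only: two distrib_left mult.assoc[symmetric])
  finally have "?S \<le> 2 powr q * (\<Sum>\<kappa>\<in>grid_index M. norm (f (z \<kappa>)) powr q)"
    by (simp add: powr_diff)
  then have "2 powr q * ?S \<le> 2 powr q * (2 powr q * (\<Sum>\<kappa>\<in>grid_index M. norm (f (z \<kappa>)) powr q))"
    by (intro mult_left_mono) auto
  also have "\<dots> = 4 powr q * (\<Sum>\<kappa>\<in>grid_index M. norm (f (z \<kappa>)) powr q)"
    by (simp add: powr_mult[symmetric] flip: mult.assoc)
  finally show ?thesis using * by linarith
qed

text \<open>With \<open>T\<close> the maximum over the corners, deviations in a cell are at most
  \<open>T / 2\<close>. Hence \<open>T \<le> 2 * L\<close>, and any value is at most
  \<open>3 / 2 * T\<close>.\<close>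

lemma norm_le_three_Max_cells:
  assumes y: "\<And>\<kappa>. \<kappa> \<in> grid_index M \<Longrightarrow> y \<kappa> \<in> grid_cell M \<kappa>"
    and L: "\<And>\<kappa>. \<kappa> \<in> grid_index M \<Longrightarrow> norm (f (y \<kappa>)) \<le> L"
    and \<kappa>: "\<kappa> \<in> grid_index M" and x: "x \<in> grid_cell M \<kappa>"
  shows "norm (f x) \<le> 3 * L"
proof -
  obtain E where E: "\<And>\<rho>. \<rho> \<in> grid_index M \<Longrightarrow> 0 \<le> E \<rho>" "(\<Sum>\<rho>\<in>grid_index M. E \<rho>) \<le> 1 / 2"
    "\<And>\<kappa> y. y \<in> grid_cell M \<kappa> \<Longrightarrow>
      norm (f y - f (grid_point M \<kappa>)) \<le> (\<Sum>\<rho>\<in>grid_index M. E \<rho> * norm (f (grid_point M (\<lambda>j. \<kappa> j + \<rho> j))))"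
    using ex_weights by blast
  define T where "T = (MAX \<kappa>\<in>grid_index M. norm (f (grid_point M \<kappa>)))"
  \<comment> \<open>Shifted corners may leave the index set, so periodicity is needed to bound them
    by \<open>T\<close>.\<close>
  have T_ge: "norm (f (grid_point M \<kappa>)) \<le> T" for \<kappa>
  proof -
    have "(\<lambda>j. \<kappa> j mod M j) \<in> grid_index M" using M_pos by (simp add: mem_grid_index)
    then have "norm (f (grid_point M (\<lambda>j. \<kappa> j mod M j))) \<le> T"
      unfolding T_def by (intro Max_ge) auto
    then show ?thesis by (simp only: trig_poly_grid_point_mod[OF f M_pos])
  qed
  have diff: "norm (f w - f (grid_point M \<kappa>)) \<le> T / 2" if "w \<in> grid_cell M \<kappa>" for w \<kappa>
  proof -
    have "norm (f w - f (grid_point M \<kappa>)) \<le> (\<Sum>\<rho>\<in>grid_index M. E \<rho> * T)"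
      by (intro order_trans[OF E(3)[OF that]] sum_mono mult_left_mono T_ge E(1))
    also have "\<dots> = (\<Sum>\<rho>\<in>grid_index M. E \<rho>) * T" by (simp add: sum_distrib_right)
    also have "\<dots> \<le> 1 / 2 * T"
      by (intro mult_right_mono E(2) order_trans[OF norm_ge_zero T_ge[of \<kappa>]])
    finally show ?thesis by simp
  qed
  have "T \<in> (\<lambda>\<kappa>. norm (f (grid_point M \<kappa>))) ` grid_index M"
    unfolding T_def using \<kappa> by (intro Max_in) auto
  then obtain \<kappa>' where \<kappa>': "\<kappa>' \<in> grid_index M" "T = norm (f (grid_point M \<kappa>'))" by auto
  have "T \<le> norm (f (y \<kappa>')) + norm (f (y \<kappa>') - f (grid_point M \<kappa>'))"
    unfolding \<kappa>'(2) by (metis add.commute norm_minus_commute diff_add_cancel norm_triangle_ineq)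
  also have "\<dots> \<le> L + T / 2"
    using \<kappa>'(1) by (intro add_mono L diff y)
  finally have "T \<le> 2 * L" by simp
  moreover have "norm (f x) \<le> norm (f (grid_point M \<kappa>)) + norm (f x - f (grid_point M \<kappa>))"
    by (metis add.commute diff_add_cancel norm_triangle_ineq)
  ultimately show ?thesis using T_ge[of \<kappa>] diff[OF x] by linarith
qed

end

section \<open>Integrals over the torus against sums over cells\<close>

lemma mem_grid_cell:
  "x \<in> grid_cell M \<kappa> \<longleftrightarrow>
    (\<forall>j. 2 * pi * real (\<kappa> j) / real (M j) \<le> x $ j \<and> x $ j \<le> 2 * pi * real (Suc (\<kappa> j)) / real (M j))"
  by (simp add: grid_cell_def mem_box_cart grid_point_def)

lemma grid_point_in_cell: "grid_point M \<kappa> \<in> grid_cell M \<kappa>"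
  by (auto simp: mem_grid_cell grid_point_def intro!: divide_right_mono)

lemma content_grid_cell:
  fixes M :: "'d::finite \<Rightarrow> nat"
  shows "measure lborel (grid_cell M \<kappa>) = (2 * pi) ^ CARD('d) / real (\<Prod>j\<in>UNIV. M j)"
proof -
  have "grid_cell M \<kappa> \<noteq> {}" using grid_point_in_cell by blast
  then have "measure lborel (grid_cell M \<kappa>)
      = (\<Prod>j\<in>UNIV. grid_point M (\<lambda>j. Suc (\<kappa> j)) $ j - grid_point M \<kappa> $ j)"
    unfolding grid_cell_def by (rule content_cbox_cart)
  also have "\<dots> = (\<Prod>j\<in>UNIV. 2 * pi / real (M j))"
    by (intro prod.cong refl) (simp add: grid_point_def algebra_simps add_divide_distrib)
  finally show ?thesis by (simp add: prod_dividef)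
qed

lemma torus_cell:
  assumes "x \<in> torus" "\<And>j. 0 < M j"
  obtains \<kappa> where "\<kappa> \<in> grid_index M" "x \<in> grid_cell M \<kappa>"
proof
  let ?k = "\<lambda>j. nat \<lfloor>x $ j * real (M j) / (2 * pi)\<rfloor>"
  have x: "0 \<le> x $ j" "x $ j < 2 * pi" for j using assms(1) by (auto simp: torus_def)
  have nonneg: "0 \<le> x $ j * real (M j) / (2 * pi)" for j using x by simp
  have k: "real (?k j) \<le> x $ j * real (M j) / (2 * pi)" "x $ j * real (M j) / (2 * pi) \<le> real (Suc (?k j))" for j
    using nonneg[of j] by linarith+
  show "?k \<in> grid_index M"
    unfolding mem_grid_index
  proof
    fix j
    have "x $ j * real (M j) < 2 * pi * real (M j)"
      using x(2)[of j] assms(2)[of j] by (intro mult_strict_right_mono) auto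
    then have "x $ j * real (M j) / (2 * pi) < real (M j)" by (simp add: field_simps)
    then show "?k j < M j" using k(1)[of j] by linarith
  qed
  show "x \<in> grid_cell M ?k"
    using k assms(2) by (simp add: mem_grid_cell field_simps del: of_nat_Suc)
qed

text \<open>The rescaled coordinate lies strictly between consecutive integers, so open boxes with
  different indices are disjoint.\<close>

lemma box_grid_cell:
  assumes "x \<in> box (grid_point M \<kappa>) (grid_point M (\<lambda>j. Suc (\<kappa> j)))" "\<And>j. 0 < M j"
  shows "real (\<kappa> j) < x $ j * real (M j) / (2 * pi)" "x $ j * real (M j) / (2 * pi) < real (Suc (\<kappa> j))"
proof -
  have "2 * pi * real (\<kappa> j) / real (M j) < x $ j" "x $ j < 2 * pi * real (Suc (\<kappa> j)) / real (M j)"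
    using assms(1) by (auto simp: mem_box_cart grid_point_def)
  then show "real (\<kappa> j) < x $ j * real (M j) / (2 * pi)" "x $ j * real (M j) / (2 * pi) < real (Suc (\<kappa> j))"
    using assms(2)[of j] by (simp_all add: field_simps del: of_nat_Suc)
qed

text \<open>The half-open torus differs from the closed cube only by a subset of its frontier, which
  is negligible.\<close>

lemma integrable_on_torus:
  fixes g :: "real^'d::finite \<Rightarrow> real"
  assumes "continuous_on UNIV g"
  shows "g integrable_on torus"
proof -
  let ?a = "0 :: real^'d" and ?b = "(\<chi> j. 2 * pi) :: real^'d"
  have sub: "box ?a ?b \<subseteq> torus" "torus \<subseteq> cbox ?a ?b"
    by (auto simp: torus_def mem_box_cart less_imp_le)
  have "g integrable_on cbox ?a ?b"
    using assms by (intro integrable_continuous) (rule continuous_on_subset, auto)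
  moreover have "negligible {x \<in> cbox ?a ?b - torus. g x \<noteq> 0}" "negligible {x \<in> torus - cbox ?a ?b. g x \<noteq> 0}"
    using sub by (auto intro: negligible_subset[OF negligible_frontier_interval])
  ultimately show ?thesis
    using has_integral_spike_set_eq[of "cbox ?a ?b" torus g] by (auto simp: integrable_on_def)
qed

text \<open>An upper sum with the maxima over closed cells. The cells cover the torus, and overlaps
  only increase the step function because \<open>g\<close> is nonnegative.\<close>

lemma integral_torus_le_cells:
  fixes g :: "real^'d::finite \<Rightarrow> real"
  assumes g: "continuous_on UNIV g" "\<And>x. 0 \<le> g x" and M: "\<And>j. 0 < M j"
  obtains z where "\<And>\<kappa>. z \<kappa> \<in> grid_cell M \<kappa>"
    "integral torus g \<le> (2 * pi) ^ CARD('d) / real (\<Prod>j\<in>UNIV. M j) * (\<Sum>\<kappa>\<in>grid_index M. g (z \<kappa>))"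
proof -
  have "\<exists>z\<in>grid_cell M \<kappa>. \<forall>x\<in>grid_cell M \<kappa>. g x \<le> g z" for \<kappa>
    using grid_point_in_cell[of M \<kappa>] continuous_on_subset[OF g(1)]
    by (intro continuous_attains_sup) (auto simp: grid_cell_def compact_cbox)
  then obtain z where z: "\<And>\<kappa>. z \<kappa> \<in> grid_cell M \<kappa>" "\<And>\<kappa> x. x \<in> grid_cell M \<kappa> \<Longrightarrow> g x \<le> g (z \<kappa>)"
    by metis
  let ?v = "(2 * pi) ^ CARD('d) / real (\<Prod>j\<in>UNIV. M j)"
  have "integral torus g = integral UNIV (\<lambda>x. if x \<in> torus then g x else 0)"
    by (simp add: integral_restrict_UNIV)
  also have "\<dots> \<le> (\<Sum>\<kappa>\<in>grid_index M. ?v * g (z \<kappa>))"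
  proof (rule has_integral_le)
    show "((\<lambda>x. if x \<in> torus then g x else 0) has_integral integral UNIV (\<lambda>x. if x \<in> torus then g x else 0)) UNIV"
      using integrable_on_torus[OF g(1)] by (intro integrable_integral) (simp add: integrable_restrict_UNIV)
    show "((\<lambda>x. \<Sum>\<kappa>\<in>grid_index M. if x \<in> grid_cell M \<kappa> then g (z \<kappa>) else 0) has_integral (\<Sum>\<kappa>\<in>grid_index M. ?v * g (z \<kappa>))) UNIV"
    proof (intro has_integral_sum finite_grid_index)
      fix \<kappa> assume "\<kappa> \<in> grid_index M"
      have "((\<lambda>x. g (z \<kappa>)) has_integral (?v * g (z \<kappa>))) (grid_cell M \<kappa>)"
        unfolding content_grid_cell[of M \<kappa>, symmetric] grid_cell_def
        by (metis real_scaleR_def has_integral_const)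
      then show "((\<lambda>x. if x \<in> grid_cell M \<kappa> then g (z \<kappa>) else 0) has_integral (?v * g (z \<kappa>))) UNIV"
        by (simp only: has_integral_restrict_UNIV)
    qed
    fix x :: "real^'d"
    show "(if x \<in> torus then g x else 0) \<le> (\<Sum>\<kappa>\<in>grid_index M. if x \<in> grid_cell M \<kappa> then g (z \<kappa>) else 0)"
    proof (cases "x \<in> torus")
      case True
      then obtain \<kappa>0 where \<kappa>0: "\<kappa>0 \<in> grid_index M" "x \<in> grid_cell M \<kappa>0" using torus_cell M by blast
      have "g x \<le> (if x \<in> grid_cell M \<kappa>0 then g (z \<kappa>0) else 0)" using \<kappa>0 z by simp
      also have "\<dots> \<le> (\<Sum>\<kappa>\<in>grid_index M. if x \<in> grid_cell M \<kappa> then g (z \<kappa>) else 0)"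
        using \<kappa>0 g(2) by (intro member_le_sum) auto
      finally show ?thesis using True by simp
    qed (auto intro!: sum_nonneg simp: g(2))
  qed
  finally show thesis using that[of z] z(1) by (simp add: sum_distrib_left)
qed

text \<open>A lower sum with the minima over closed cells. Here the step function lives on the open
  boxes, since overlaps would spoil the pointwise bound.\<close>

lemma integral_torus_ge_cells:
  fixes g :: "real^'d::finite \<Rightarrow> real"
  assumes g: "continuous_on UNIV g" "\<And>x. 0 \<le> g x" and M: "\<And>j. 0 < M j"
  obtains z where "\<And>\<kappa>. z \<kappa> \<in> grid_cell M \<kappa>"
    "(2 * pi) ^ CARD('d) / real (\<Prod>j\<in>UNIV. M j) * (\<Sum>\<kappa>\<in>grid_index M. g (z \<kappa>)) \<le> integral torus g"
proof -
  have "\<exists>z\<in>grid_cell M \<kappa>. \<forall>x\<in>grid_cell M \<kappa>. g z \<le> g x" for \<kappa>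
    using grid_point_in_cell[of M \<kappa>] continuous_on_subset[OF g(1)]
    by (intro continuous_attains_inf) (auto simp: grid_cell_def compact_cbox)
  then obtain z where z: "\<And>\<kappa>. z \<kappa> \<in> grid_cell M \<kappa>" "\<And>\<kappa> x. x \<in> grid_cell M \<kappa> \<Longrightarrow> g (z \<kappa>) \<le> g x"
    by metis
  let ?v = "(2 * pi) ^ CARD('d) / real (\<Prod>j\<in>UNIV. M j)"
  let ?b = "\<lambda>\<kappa>. box (grid_point M \<kappa>) (grid_point M (\<lambda>j. Suc (\<kappa> j)))"
  have "(\<Sum>\<kappa>\<in>grid_index M. ?v * g (z \<kappa>)) \<le> integral UNIV (\<lambda>x. if x \<in> torus then g x else 0)"
  proof (rule has_integral_le)
    show "((\<lambda>x. if x \<in> torus then g x else 0) has_integral integral UNIV (\<lambda>x. if x \<in> torus then g x else 0)) UNIV"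
      using integrable_on_torus[OF g(1)] by (intro integrable_integral) (simp add: integrable_restrict_UNIV)
    show "((\<lambda>x. \<Sum>\<kappa>\<in>grid_index M. if x \<in> ?b \<kappa> then g (z \<kappa>) else 0) has_integral (\<Sum>\<kappa>\<in>grid_index M. ?v * g (z \<kappa>))) UNIV"
    proof (intro has_integral_sum finite_grid_index)
      fix \<kappa> assume "\<kappa> \<in> grid_index M"
      have "((\<lambda>x. g (z \<kappa>)) has_integral (?v * g (z \<kappa>))) (?b \<kappa>)"
        unfolding content_grid_cell[of M \<kappa>, symmetric] grid_cell_def has_integral_open_interval
        by (metis real_scaleR_def has_integral_const)
      then show "((\<lambda>x. if x \<in> ?b \<kappa> then g (z \<kappa>) else 0) has_integral (?v * g (z \<kappa>))) UNIV"
        by (simp only: has_integral_restrict_UNIV)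
    qed
    fix x :: "real^'d"
    show "(\<Sum>\<kappa>\<in>grid_index M. if x \<in> ?b \<kappa> then g (z \<kappa>) else 0) \<le> (if x \<in> torus then g x else 0)"
    proof (cases "\<exists>\<kappa>\<in>grid_index M. x \<in> ?b \<kappa>")
      case True
      then obtain \<kappa>0 where \<kappa>0: "\<kappa>0 \<in> grid_index M" "x \<in> ?b \<kappa>0" by blast
      have uniq: "\<kappa> = \<kappa>0" if "x \<in> ?b \<kappa>" for \<kappa>
      proof
        fix j
        show "\<kappa> j = \<kappa>0 j"
          using box_grid_cell[OF that M, of j] box_grid_cell[OF \<kappa>0(2) M, of j] by linarith
      qed
      have "x \<in> torus"
        unfolding torus_def
      proof (intro CollectI allI conjI)
        fix j
        note b = box_grid_cell[OF \<kappa>0(2) M, of j]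
        have Mj: "real (M j) > 0" using M[of j] by simp
        have "0 < x $ j * real (M j) / (2 * pi)" using b(1) by (meson of_nat_0_le_iff order_le_less_trans)
        then show "0 \<le> x $ j" using Mj by (simp add: zero_less_divide_iff zero_less_mult_iff)
        have "real (Suc (\<kappa>0 j)) \<le> real (M j)" using \<kappa>0(1) by (simp add: mem_grid_index Suc_le_eq del: of_nat_Suc)
        then have "x $ j * real (M j) / (2 * pi) < real (M j)" using b(2) by linarith
        then have "x $ j * real (M j) < 2 * pi * real (M j)" by (simp add: field_simps)
        then show "x $ j < 2 * pi" using Mj by (simp add: mult_less_cancel_right)
      qed
      moreover have "(\<Sum>\<kappa>\<in>grid_index M. if x \<in> ?b \<kappa> then g (z \<kappa>) else 0) = (\<Sum>\<kappa>\<in>grid_index M. if \<kappa> = \<kappa>0 then g (z \<kappa>0) else 0)"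
      proof (intro sum.cong refl)
        fix \<kappa>
        have "x \<in> ?b \<kappa> \<longleftrightarrow> \<kappa> = \<kappa>0" using uniq[of \<kappa>] \<kappa>0(2) by blast
        then show "(if x \<in> ?b \<kappa> then g (z \<kappa>) else 0) = (if \<kappa> = \<kappa>0 then g (z \<kappa>0) else 0)" by simp
      qed
      moreover have "x \<in> grid_cell M \<kappa>0"
        using \<kappa>0(2) box_subset_cbox unfolding grid_cell_def by blast
      ultimately show ?thesis using \<kappa>0(1) z(2) by simp
    next
      case False
      then have "(\<Sum>\<kappa>\<in>grid_index M. if x \<in> ?b \<kappa> then g (z \<kappa>) else 0) = 0" by (intro sum.neutral) auto
      then show ?thesis using g(2) by simp
    qed
  qed
  also have "\<dots> = integral torus g"
    by (simp add: integral_restrict_UNIV)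
  finally show thesis using that[of z] z(1) by (simp add: sum_distrib_left)
qed

lemma trig_poly_continuous:
  assumes "f \<in> trig_polys Q"
  shows "continuous_on S f"
proof -
  obtain c where "\<And>x. f x = (\<Sum>k\<in>Q. c k * cis (\<Sum>j\<in>UNIV. real_of_int (k j) * x $ j))"
    using trig_polysE[OF assms] by blast
  then have "f = (\<lambda>x. \<Sum>k\<in>Q. c k * cis (\<Sum>j\<in>UNIV. real_of_int (k j) * x $ j))" by blast
  then show ?thesis by (simp, intro continuous_intros)
qed

lemma trig_poly_bdd_above:
  assumes "f \<in> trig_polys Q"
  shows "bdd_above ((\<lambda>x. norm (f x)) ` S)"
proof -
  obtain c where c: "\<And>x. f x = (\<Sum>k\<in>Q. c k * cis (\<Sum>j\<in>UNIV. real_of_int (k j) * x $ j))"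
    using trig_polysE[OF assms] by blast
  have "norm (f x) \<le> (\<Sum>k\<in>Q. norm (c k))" for x
    unfolding c by (intro sum_norm_le) (simp add: norm_mult)
  then show ?thesis by (intro bdd_aboveI2)
qed

subsection \<open>Halton points\<close>

definition halton :: "('d::finite \<Rightarrow> nat) \<Rightarrow> nat \<Rightarrow> real^'d" where
  "halton p i = (\<chi> j. 2 * pi * van_der_corput (p j) i)"

lemma halton_in_torus:
  assumes "\<And>j. 2 \<le> p j"
  shows "halton p i \<in> torus"
  using assms by (simp add: halton_def torus_def van_der_corput_nonneg van_der_corput_less_1)

lemma halton_in_cell:
  assumes "\<And>j. 2 \<le> p j"
  shows "halton p i \<in> grid_cell (\<lambda>j. p j ^ c j) (\<lambda>j. digit_reversal (p j) (c j) i)"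
  unfolding mem_grid_cell
proof (intro allI conjI)
  fix j
  let ?r = "digit_reversal (p j) (c j) i" and ?v = "van_der_corput (p j) i"
  have p: "real (p j) ^ c j > 0" using assms[of j] by simp
  have "real ?r \<le> real (p j) ^ c j * ?v" "real (p j) ^ c j * ?v \<le> real (Suc ?r)"
    unfolding van_der_corput_scaled[OF assms]
    using van_der_corput_nonneg[OF assms] less_imp_le[OF van_der_corput_less_1[OF assms]] by auto
  then have "2 * pi * real ?r \<le> 2 * pi * (real (p j) ^ c j * ?v)"
    "2 * pi * (real (p j) ^ c j * ?v) \<le> 2 * pi * real (Suc ?r)"
    by (intro mult_left_mono; simp)+
  then show "2 * pi * real ?r / real (p j ^ c j) \<le> halton p i $ j"
    "halton p i $ j \<le> 2 * pi * real (Suc ?r) / real (p j ^ c j)"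
    using p by (simp_all add: halton_def pos_divide_le_eq pos_le_divide_eq mult_ac del: of_nat_Suc)
qed

text \<open>The bijection between a block and the grid cells lets \<open>y\<close> select the block
  point belonging to each cell. Membership in the block serves the sup norm, the sum identity serves
  finite \<open>q\<close>.\<close>

lemma halton_block:
  fixes p c M :: "'d::finite \<Rightarrow> nat" and l G :: nat
  assumes p: "\<And>j. 2 \<le> p j" "\<And>j j'. j \<noteq> j' \<Longrightarrow> coprime (p j) (p j')"
    and M: "M = (\<lambda>j. p j ^ c j)" and G: "G = (\<Prod>j\<in>UNIV. M j)"
  shows "\<exists>y. (\<forall>\<kappa>\<in>grid_index M. y \<kappa> \<in> grid_cell M \<kappa> \<inter> halton p ` {l * G..<l * G + G}) \<and>
    (\<forall>g :: _ \<Rightarrow> real. (\<Sum>i\<in>{l * G..<l * G + G}. g (halton p i)) = (\<Sum>\<kappa>\<in>grid_index M. g (y \<kappa>)))"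
proof -
  define X where "X = {l * G..<l * G + G}"
  let ?r = "\<lambda>i j. digit_reversal (p j) (c j) i"
  have bij: "bij_betw ?r X (grid_index M)"
    unfolding X_def M G grid_index_def by (rule digit_reversal_bij_betw_block[OF p])
  let ?y = "\<lambda>\<kappa>. halton p (inv_into X ?r \<kappa>)"
  show ?thesis
    unfolding X_def[symmetric]
  proof (intro exI[of _ ?y] conjI ballI allI)
    fix \<kappa> assume \<kappa>: "\<kappa> \<in> grid_index M"
    have "?r (inv_into X ?r \<kappa>) = \<kappa>"
      using bij \<kappa> by (rule bij_betw_inv_into_right)
    moreover have "inv_into X ?r \<kappa> \<in> X"
      using bij \<kappa> by (metis bij_betw_imp_surj_on inv_into_into)
    ultimately show "?y \<kappa> \<in> grid_cell M \<kappa> \<inter> halton p ` X"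
      using halton_in_cell[of p, OF p(1), where c = c and i = "inv_into X ?r \<kappa>"] by (simp add: M)
  next
    fix g :: "real^'d \<Rightarrow> real"
    have "(\<Sum>i\<in>X. g (halton p i)) = (\<Sum>i\<in>X. g (?y (?r i)))"
      using bij_betw_inv_into_left[OF bij] by (intro sum.cong refl) simp
    also have "\<dots> = (\<Sum>\<kappa>\<in>grid_index M. g (?y \<kappa>))"
      by (rule sum.reindex_bij_betw[OF bij])
    finally show "(\<Sum>i\<in>X. g (halton p i)) = (\<Sum>\<kappa>\<in>grid_index M. g (?y \<kappa>))" .
  qed
qed

section \<open>Universal discretization by an initial segment of the Halton sequence\<close>

lemma ex_power_between:
  fixes p x :: nat
  assumes "2 \<le> p" "0 < x"
  shows "\<exists>c. x \<le> p ^ c \<and> p ^ c \<le> p * x"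
proof -
  define c where "c = (LEAST c. x \<le> p ^ c)"
  have "x \<le> p ^ x" using power_gt_expt[of p x] assms by (simp add: less_imp_le)
  then have c: "x \<le> p ^ c" unfolding c_def by (rule LeastI)
  moreover have "p ^ c \<le> p * x"
  proof (cases c)
    case (Suc c')
    then have "\<not> x \<le> p ^ c'" unfolding c_def by (metis not_less_Least lessI)
    then show ?thesis using Suc by simp
  qed (use assms in auto)
  ultimately show ?thesis by blast
qed

text \<open>The exponent \<open>a\<close> is the oversampling. \<open>2 \<le> a\<close> yields
  \<open>3 * N j \<le> M j\<close>, and the second bound yields the condition
  \<open>fine\<close>.\<close>

locale halton_discretization =
  fixes p :: "'d::finite \<Rightarrow> nat" and a :: nat
  assumes p: "\<And>j. 2 \<le> p j" "\<And>j j'. j \<noteq> j' \<Longrightarrow> coprime (p j) (p j')"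
    and a: "2 \<le> a" "4 * pi * real CARD('d) / 2 ^ a \<le> ln (3 / 2)"
begin

definition P :: nat where "P = (\<Prod>j\<in>UNIV. p j)"

text \<open>An upper bound for the number of cells of the adapted grid, common to all shapes of
  total degree \<open>n\<close>.\<close>

definition num :: "nat \<Rightarrow> nat" where "num n = P * 2 ^ (n + a * CARD('d))"

lemma P_pos: "0 < P"
  unfolding P_def using less_le_trans[OF pos2 p(1)] by (intro prod_pos) simp

lemma num_pos: "0 < num n"
  using P_pos by (simp add: num_def)

text \<open>Each \<open>2 ^ (s j + a)\<close> is rounded up to a power of \<open>p j\<close>, losing
  at most the factor \<open>p j\<close>. The total loss is at most \<open>P\<close>, whatever the
  shape.\<close>

lemma adapted_grid:
  fixes f :: "real^'d \<Rightarrow> complex"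
  assumes "X \<in> hcross_coll n" "f \<in> X"
  obtains c N Q where "fine_grid N (\<lambda>j. p j ^ c j) Q f"
    "(\<Prod>j\<in>UNIV. p j ^ c j) \<le> num n" "num n \<le> P * (\<Prod>j\<in>UNIV. p j ^ c j)"
proof -
  obtain s :: "'d \<Rightarrow> nat" where X: "X = trig_polys (rect s)" and s: "(\<Sum>j\<in>UNIV. s j) = n"
    using assms(1) by (auto simp: hcross_coll_def)
  have "\<exists>c. 2 ^ (s j + a) \<le> p j ^ c \<and> p j ^ c \<le> p j * 2 ^ (s j + a)" for j
    using p(1) by (intro ex_power_between) auto
  then obtain c where c: "\<And>j. 2 ^ (s j + a) \<le> p j ^ c j" "\<And>j. p j ^ c j \<le> p j * 2 ^ (s j + a)"
    by metis
  have prod2: "(\<Prod>j\<in>UNIV. 2 ^ (s j + a)) = (2::nat) ^ (n + a * CARD('d))"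
    using s by (simp add: power_sum[symmetric] sum.distrib mult.commute)
  show thesis
  proof
    have "(\<Prod>j\<in>UNIV. p j ^ c j) \<le> (\<Prod>j\<in>UNIV. p j * 2 ^ (s j + a))"
      using c(2) by (intro prod_mono) auto
    then show "(\<Prod>j\<in>UNIV. p j ^ c j) \<le> num n"
      by (simp only: prod.distrib prod2 num_def P_def)
    have "(\<Prod>j\<in>UNIV. 2 ^ (s j + a)) \<le> (\<Prod>j\<in>UNIV. p j ^ c j)"
      using c(1) by (intro prod_mono) auto
    then show "num n \<le> P * (\<Prod>j\<in>UNIV. p j ^ c j)"
      unfolding num_def prod2 by simp
    show "fine_grid (\<lambda>j. 2 ^ s j) (\<lambda>j. p j ^ c j) (rect s) f"
    proof
      fix j
      have "(2::nat) ^ 2 \<le> 2 ^ a" using a(1) by (intro power_increasing) auto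
      then have "(3::nat) * 2 ^ s j \<le> 2 ^ a * 2 ^ s j" by (intro mult_right_mono) auto
      also have "\<dots> \<le> p j ^ c j" using c(1)[of j] by (simp add: power_add mult.commute)
      finally show "3 * 2 ^ s j \<le> p j ^ c j" .
    next
      have "(\<Sum>j\<in>UNIV. 4 * pi * real (2 ^ s j) / real (p j ^ c j)) \<le> (\<Sum>j\<in>(UNIV::'d set). 4 * pi / 2 ^ a)"
      proof (rule sum_mono)
        fix j
        have "real (2 ^ (s j + a)) \<le> real (p j ^ c j)" using c(1)[of j] by (simp only: of_nat_le_iff)
        then have "4 * pi * real (2 ^ s j) / real (p j ^ c j) \<le> 4 * pi * real (2 ^ s j) / real (2 ^ (s j + a))"
          using p(1)[of j] by (intro divide_left_mono) auto
        also have "\<dots> = 4 * pi / 2 ^ a" by (simp add: power_add)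
        finally show "4 * pi * real (2 ^ s j) / real (p j ^ c j) \<le> 4 * pi / 2 ^ a" .
      qed
      also have "\<dots> \<le> ln (3 / 2)" using a(2) by (simp add: mult_ac)
      finally show "exp (\<Sum>j\<in>UNIV. 4 * pi * real (2 ^ s j) / real (p j ^ c j)) \<le> 3 / 2"
        by (subst ln_ge_iff[symmetric]) auto
    next
      show "f \<in> trig_polys (rect s)" using assms(2) X by simp
    qed (auto simp: rect_def)
  qed
qed

text \<open>The block with \<open>l = 0\<close> lies among the first \<open>num n\<close> points and
  meets every cell of the adapted grid.\<close>

lemma udisc_Linf_halton: "udisc_Linf (1 / 3) (num n) (halton p) (hcross_coll n)"
  unfolding udisc_Linf_def
proof (intro ballI conjI)
  fix X and f :: "real^'d \<Rightarrow> complex" assume Xf: "X \<in> hcross_coll n" "f \<in> X"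
  obtain c N Q where fg: "fine_grid N (\<lambda>j. p j ^ c j) Q f" and G: "(\<Prod>j\<in>UNIV. p j ^ c j) \<le> num n"
    using adapted_grid[OF Xf] by metis
  interpret fine_grid N "\<lambda>j. p j ^ c j" Q f by (fact fg)
  let ?L = "MAX \<nu>\<in>{..<num n}. norm (f (halton p \<nu>))"
  obtain y where y: "\<forall>\<kappa>\<in>grid_index (\<lambda>j. p j ^ c j). y \<kappa> \<in> grid_cell (\<lambda>j. p j ^ c j) \<kappa> \<inter>
        halton p ` {0 * (\<Prod>j\<in>UNIV. p j ^ c j)..<0 * (\<Prod>j\<in>UNIV. p j ^ c j) + (\<Prod>j\<in>UNIV. p j ^ c j)}"
    using halton_block[of p, OF p refl refl, where c = c and l = 0] by blast
  have L: "norm (f (y \<kappa>)) \<le> ?L" if \<kappa>: "\<kappa> \<in> grid_index (\<lambda>j. p j ^ c j)" for \<kappa>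
  proof -
    obtain i where i: "y \<kappa> = halton p i" "i < (\<Prod>j\<in>UNIV. p j ^ c j)" using bspec[OF y \<kappa>] by auto
    then have "i < num n" using G by linarith
    then show ?thesis unfolding i(1) by (intro Max_ge) auto
  qed
  have "norm (f x) \<le> 3 * ?L" if x: "x \<in> torus" for x
  proof -
    obtain \<kappa> where "\<kappa> \<in> grid_index (\<lambda>j. p j ^ c j)" "x \<in> grid_cell (\<lambda>j. p j ^ c j) \<kappa>"
      using torus_cell[of x "\<lambda>j. p j ^ c j", OF x M_pos] by blast
    then show ?thesis using y L by (intro norm_le_three_Max_cells[of y]) auto
  qed
  moreover have "(torus :: (real^'d) set) \<noteq> {}" using halton_in_torus[OF p(1)] by blast
  ultimately have "sup_norm f \<le> 3 * ?L"
    unfolding sup_norm_def by (intro cSUP_least) auto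
  then show "1 / 3 * sup_norm f \<le> ?L" by simp
  show "?L \<le> sup_norm f"
    unfolding sup_norm_def using num_pos[of n]
    by (intro Max.boundedI) (auto intro!: cSUP_upper trig_poly_bdd_above[OF f] halton_in_torus p(1))
qed

lemma udisc_Lq_halton:
  assumes q: "1 \<le> q"
  shows "udisc_Lq q (1 / (real P * 4 powr q)) (real P * 4 powr q) (num n) (halton p) (hcross_coll n)"
  unfolding udisc_Lq_def
proof (intro ballI)
  fix X and f :: "real^'d \<Rightarrow> complex" assume Xf: "X \<in> hcross_coll n" "f \<in> X"
  obtain c N Q where fg: "fine_grid N (\<lambda>j. p j ^ c j) Q f"
    and G: "(\<Prod>j\<in>UNIV. p j ^ c j) \<le> num n" "num n \<le> P * (\<Prod>j\<in>UNIV. p j ^ c j)"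
    using adapted_grid[OF Xf] by metis
  define M where "M = (\<lambda>j. p j ^ c j)"
  define G where "G = (\<Prod>j\<in>UNIV. M j)"
  interpret fine_grid N M Q f using fg by (simp add: M_def)
  define g where "g x = norm (f x) powr q" for x
  have g_nonneg: "0 \<le> g x" for x by (simp add: g_def)
  have g_cont: "continuous_on UNIV g"
    unfolding g_def using q by (intro continuous_on_powr' continuous_intros trig_poly_continuous[OF f]) auto
  have G_pos: "0 < G" using M_pos by (simp add: G_def prod_pos)
  have G_le: "G \<le> num n" and num_le: "num n \<le> P * G" using G by (simp_all add: G_def M_def)
  have lq: "Lq_norm_pow q f = integral torus g / (2 * pi) ^ CARD('d)"
    by (simp add: Lq_norm_pow_def g_def[abs_def])
  have cmp: "(\<Sum>\<kappa>\<in>grid_index M. g (y \<kappa>)) \<le> 4 powr q * (\<Sum>\<kappa>\<in>grid_index M. g (z \<kappa>))"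
    if "\<And>\<kappa>. \<kappa> \<in> grid_index M \<Longrightarrow> y \<kappa> \<in> grid_cell M \<kappa>" "\<And>\<kappa>. \<kappa> \<in> grid_index M \<Longrightarrow> z \<kappa> \<in> grid_cell M \<kappa>" for y z
    unfolding g_def by (rule sum_powr_cells_le[OF q that])
  \<comment> \<open>A cell has normalized volume \<open>1 / G\<close>. The block points are compared
    with the points of maximum for the first bound and of minimum for the second.\<close>
  have block: "real G * Lq_norm_pow q f \<le> 4 powr q * (\<Sum>i\<in>{l * G..<l * G + G}. g (halton p i))"
    "(\<Sum>i\<in>{l * G..<l * G + G}. g (halton p i)) \<le> 4 powr q * (real G * Lq_norm_pow q f)" for l
  proof -
    obtain y where y: "\<forall>\<kappa>\<in>grid_index M. y \<kappa> \<in> grid_cell M \<kappa> \<inter> halton p ` {l * G..<l * G + G}"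
      and sum_y: "\<forall>g :: _ \<Rightarrow> real. (\<Sum>i\<in>{l * G..<l * G + G}. g (halton p i)) = (\<Sum>\<kappa>\<in>grid_index M. g (y \<kappa>))"
      using halton_block[of p, OF p M_def G_def, where l = l] by blast
    obtain z where z: "\<And>\<kappa>. z \<kappa> \<in> grid_cell M \<kappa>"
      and int_z: "integral torus g \<le> (2 * pi) ^ CARD('d) / real G * (\<Sum>\<kappa>\<in>grid_index M. g (z \<kappa>))"
      using integral_torus_le_cells[of g M, OF g_cont g_nonneg M_pos, folded G_def] by blast
    have "real G * Lq_norm_pow q f \<le> (\<Sum>\<kappa>\<in>grid_index M. g (z \<kappa>))"
      using int_z G_pos by (simp add: lq field_simps)
    also have "\<dots> \<le> 4 powr q * (\<Sum>\<kappa>\<in>grid_index M. g (y \<kappa>))" by (intro cmp IntD1[OF bspec[OF y]] z)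
    finally show "real G * Lq_norm_pow q f \<le> 4 powr q * (\<Sum>i\<in>{l * G..<l * G + G}. g (halton p i))"
      by (simp only: sum_y[rule_format])
    obtain w where w: "\<And>\<kappa>. w \<kappa> \<in> grid_cell M \<kappa>"
      and int_w: "(2 * pi) ^ CARD('d) / real G * (\<Sum>\<kappa>\<in>grid_index M. g (w \<kappa>)) \<le> integral torus g"
      using integral_torus_ge_cells[of g M, OF g_cont g_nonneg M_pos, folded G_def] by blast
    have "(\<Sum>\<kappa>\<in>grid_index M. g (y \<kappa>)) \<le> 4 powr q * (\<Sum>\<kappa>\<in>grid_index M. g (w \<kappa>))" by (intro cmp IntD1[OF bspec[OF y]] w)
    also have "\<dots> \<le> 4 powr q * (real G * Lq_norm_pow q f)"
      using int_w G_pos by (intro mult_left_mono) (auto simp: lq field_simps)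
    finally show "(\<Sum>i\<in>{l * G..<l * G + G}. g (halton p i)) \<le> 4 powr q * (real G * Lq_norm_pow q f)"
      by (simp only: sum_y[rule_format])
  qed
  let ?L = "Lq_norm_pow q f" and ?S = "\<Sum>\<nu><num n. g (halton p \<nu>)"
  have L_nonneg: "0 \<le> ?L"
    using g_nonneg by (simp add: lq integral_nonneg[OF integrable_on_torus[OF g_cont]])
  \<comment> \<open>For the lower bound one block inside the first \<open>num n\<close> points
    suffices, since \<open>num n\<close> is at most \<open>P\<close> block lengths.\<close>
  have "real (num n) * ?L \<le> real P * real G * ?L"
    using num_le L_nonneg by (intro mult_right_mono) (simp_all flip: of_nat_mult)
  also have "\<dots> \<le> real P * (4 powr q * (\<Sum>i\<in>{0 * G..<0 * G + G}. g (halton p i)))"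
    using block(1)[of 0] by (simp only: mult.assoc) (intro mult_left_mono, auto)
  also have "\<dots> \<le> real P * (4 powr q * ?S)"
    using G_le g_nonneg by (intro mult_left_mono sum_mono2) auto
  finally have "real (num n) * ?L \<le> real P * (4 powr q * ?S)" .
  then have lower: "1 / (real P * 4 powr q) * ?L \<le> ?S / real (num n)"
    using P_pos num_pos[of n] by (simp add: field_simps)
  \<comment> \<open>For the upper bound the points are covered by \<open>P\<close> consecutive
    blocks.\<close>
  have "?S \<le> (\<Sum>\<nu><P * G. g (halton p \<nu>))"
    using num_le g_nonneg by (intro sum_mono2) auto
  also have "\<dots> = (\<Sum>l<P. \<Sum>i\<in>{l * G..<l * G + G}. g (halton p i))"
    by (rule sum.nat_group[symmetric])
  also have "\<dots> \<le> (\<Sum>l<P. 4 powr q * (real G * ?L))"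
    by (intro sum_mono block(2))
  also have "\<dots> = real P * 4 powr q * ?L * real G" by simp
  also have "\<dots> \<le> real P * 4 powr q * ?L * real (num n)"
    using G_le L_nonneg by (intro mult_left_mono) auto
  finally have upper: "?S / real (num n) \<le> real P * 4 powr q * ?L"
    using num_pos[of n] by (simp add: pos_divide_le_eq)
  show "1 / (real P * 4 powr q) * ?L \<le> (\<Sum>\<nu><num n. norm (f (halton p \<nu>)) powr q) / real (num n) \<and>
      (\<Sum>\<nu><num n. norm (f (halton p \<nu>)) powr q) / real (num n) \<le> real P * 4 powr q * ?L"
    using lower upper by (simp add: g_def)
qed

end

theorem theorem1p1:
  fixes q :: ereal
  assumes "1 \<le> q"
  shows "\<exists>C>0. \<exists>C1>0. \<exists>C2>0. \<forall>n::nat. \<exists>m (\<xi> :: nat \<Rightarrow> real^'d::finite).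
           0 < m \<and> real m \<le> C * 2 ^ n \<and> (\<forall>\<nu><m. \<xi> \<nu> \<in> torus) \<and>
           (if q = \<infinity> then udisc_Linf C1 m \<xi> (hcross_coll n)
            else udisc_Lq (real_of_ereal q) C1 C2 m \<xi> (hcross_coll n))"
proof -
  obtain p :: "'d \<Rightarrow> nat" where p: "\<forall>j. 2 \<le> p j" "\<forall>j j'. j \<noteq> j' \<longrightarrow> coprime (p j) (p j')"
    using ex_coprime_family by blast
  obtain a0 :: nat where a0: "4 * pi * real CARD('d) / ln (3 / 2) < 2 ^ a0"
    using real_arch_pow[of 2] by auto
  \<comment> \<open>The two extra doublings secure \<open>2 \<le> a\<close>.\<close>
  have "(2::real) ^ a0 \<le> 2 ^ (a0 + 2)" by simp
  with a0 have "4 * pi * real CARD('d) / ln (3 / 2) \<le> 2 ^ (a0 + 2)" by linarith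
  then have "4 * pi * real CARD('d) / 2 ^ (a0 + 2) \<le> ln (3 / 2)"
    by (simp add: pos_divide_le_eq mult.commute)
  then obtain a :: nat where a: "2 \<le> a" "4 * pi * real CARD('d) / 2 ^ a \<le> ln (3 / 2)"
    using le_add2 by blast
  interpret halton_discretization p a
    using p a by unfold_locales auto
  \<comment> \<open>Both factors come from \<open>p\<close> and \<open>a\<close>, which were chosen
    from the dimension alone. The same Halton sequence then serves every \<open>n\<close> and
    \<open>q\<close>.\<close>
  define C where "C = real P * 2 ^ (a * CARD('d))"
  have C: "0 < C" "real (num n) \<le> C * 2 ^ n" for n
    using P_pos by (simp_all add: C_def num_def power_add)
  show ?thesis
  proof (cases "q = \<infinity>")
    case True
    show ?thesis
      using C num_pos halton_in_torus[OF p(1)[rule_format]] udisc_Linf_halton True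
      by (intro exI[of _ C] exI[of _ "1 / 3"] exI[of _ 1] conjI allI exI[of _ "num _"] exI[of _ "halton p"]) auto
  next
    case False
    define r where "r = real_of_ereal q"
    have "1 \<le> r" using assms False unfolding r_def by (cases q) auto
    note Lq = udisc_Lq_halton[OF this]
    show ?thesis
      using C num_pos P_pos halton_in_torus[OF p(1)[rule_format]] Lq False
      by (intro exI[of _ C] exI[of _ "1 / (real P * 4 powr r)"] exI[of _ "real P * 4 powr r"]
          conjI allI exI[of _ "num _"] exI[of _ "halton p"]) (auto simp: r_def)
  qed
qed

end
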